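(* Let $\mu_1,\mu_2,c>0$, let $g(\pi)=\pi_1\wedge(1-\pi_1)\wedge\pi_2\wedge(1-\pi_2)$ for $\pi=(\pi_1,\pi_2)\in[0,1]^2$, let $$V(\pi)=\inf_\tau\mathbb E_\pi\left[g(\Pi_\tau)+c\tau\right],$$ and let $\mathcal C=\{\pi\in[0,1]^2:V(\pi)<g(\pi)\}$ be the continuation region. For $i=1,2$ let $(A_i^*,1-A_i^* )$ be the continuation region of the one-dimensional sequential testing problem $ST(\mu_i,c)$. Then the rectangle $$R:=(A_1^*,1-A_1^* )\times(A_2^*,1-A_2^* )$$ is contained in $\mathcal C$.
   Context: Set-up (two-dimensional sequential testing). For $\pi\in[0,1]^2$, under $\mathbb P_\pi$ (expectation $\mathbb E_\pi$) the random variables $Y^1,Y^2$ take values in $\{0,1\}$ with $\mathbb P_\pi(Y^i=1)=\pi_i$, $W^1,W^2$ are standard Brownian motions, and $Y^1,Y^2,W^1,W^2$ are independent. One observes $X=(X^1,X^2)$ with $X^i_t=\mu_iY^it+W^i_t$, and $\mathcal F^X$ is the filtration generated by $X$. The posterior process $\Pi=(\Pi^1,\Pi^2)$ is $\Pi^i_t=\mathbb E_\pi[Y^i\mid\mathcal F^X_t]$ (continuous version); it satisfies $\Pi_0=\pi$ and $d\Pi^i_t=\mu_i\Pi^i_t(1-\Pi^i_t)\,d\bar W^i_t$, where $\bar W^i_t=X^i_t-\mu_i\int_0^t\Pi^i_s\,ds$ and $(\bar W^1,\bar W^2)$ is a two-dimensional standard Brownian motion. The infimum in $V$ is over ($\mathbb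 P_\pi$-a.s. finite) $\mathcal F^X$-stopping times. One-dimensional problem $ST(\mu,c)$, for $\mu,c>0$: with $\Pi$ the one-dimensional posterior process defined in the same way from a single observation $X_t=\mu Yt+W_t$ with $\mathbb P_\pi(Y=1)=\pi\in[0,1]$ (so $d\Pi_t=\mu\Pi_t(1-\Pi_t)\,d\bar W_t$, $\Pi_0=\pi$), set $u^{\mu,c}(\pi)=\inf_\tau\mathbb E_\pi[\Pi_\tau\wedge(1-\Pi_\tau)+c\tau]$. It is known that $u^{\mu,c}$ is concave and that its continuation region $\{\pi\in[0,1]:u^{\mu,c}(\pi)<\pi\wedge(1-\pi)\}$ is of the form $(A^*,1-A^* )$ for some $A^*\in(0,1/2)$, and that the first exit time of $\Pi$ from $(A^*,1-A^* )$ is optimal for $u^{\mu,c}$; $A_i^*$ denotes this $A^*$ for $ST(\mu_i,c)$. *)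

theory Defs
  imports "HOL-Probability.Probability"
begin

text \<open>
  Processes are indexed by real times, of which only the nonnegative ones matter. Filtrations are
  indexed by \<^typ>\<open>ennreal\<close>, so that the library's \<^const>\<open>stopping_time\<close> covers random times with
  values in \<open>[0, \<infinity>]\<close>; the condition it imposes at time \<open>\<infinity>\<close> is vacuous.
\<close>

definition natural_filtration ::
    "'a set \<Rightarrow> (real \<Rightarrow> 'a \<Rightarrow> 'b::topological_space) \<Rightarrow> ennreal \<Rightarrow> 'a measure" where
  "natural_filtration \<Omega> X t =
     sigma \<Omega> {X s -` B \<inter> \<Omega> | s B. 0 \<le> s \<and> ennreal s \<le> t \<and> B \<in> sets borel}"

definition standard_brownian_motion :: "'a measure \<Rightarrow> (real \<Rightarrow> 'a \<Rightarrow> real) \<Rightarrow> bool" where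
  "standard_brownian_motion M W \<longleftrightarrow>
     (\<forall>t\<ge>0. W t \<in> borel_measurable M) \<and>
     (AE \<omega> in M. W 0 \<omega> = 0) \<and>
     (\<forall>s t. 0 \<le> s \<longrightarrow> s < t \<longrightarrow>
        distributed M lborel (\<lambda>\<omega>. W t \<omega> - W s \<omega>) (normal_density 0 (sqrt (t - s)))) \<and>
     (\<forall>n (ts :: nat \<Rightarrow> real). 0 \<le> ts 0 \<longrightarrow> (\<forall>k<n. ts k < ts (Suc k)) \<longrightarrow>
        prob_space.indep_vars M (\<lambda>_. borel) (\<lambda>k \<omega>. W (ts (Suc k)) \<omega> - W (ts k) \<omega>) {..<n}) \<and>
     (AE \<omega> in M. continuous_on {0..} (\<lambda>t. W t \<omega>))"

definition bernoulli_rv :: "'a measure \<Rightarrow> real \<Rightarrow> ('a \<Rightarrow> real) \<Rightarrow> bool" where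
  "bernoulli_rv M p Y \<longleftrightarrow>
     Y \<in> borel_measurable M \<and> (\<forall>\<omega>\<in>space M. Y \<omega> \<in> {0, 1}) \<and>
     measure M {\<omega> \<in> space M. Y \<omega> = 1} = p"

definition observation ::
    "real \<Rightarrow> ('a \<Rightarrow> real) \<Rightarrow> (real \<Rightarrow> 'a \<Rightarrow> real) \<Rightarrow> real \<Rightarrow> 'a \<Rightarrow> real" where
  "observation \<mu> Y W t \<omega> = \<mu> * Y \<omega> * t + W t \<omega>"

definition posterior_process ::
    "'a measure \<Rightarrow> (ennreal \<Rightarrow> 'a measure) \<Rightarrow> ('a \<Rightarrow> real) \<Rightarrow> (real \<Rightarrow> 'a \<Rightarrow> real) \<Rightarrow> bool" where
  "posterior_process M F Y Z \<longleftrightarrow>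
     (\<forall>t\<ge>0. Z t \<in> borel_measurable (F (ennreal t)) \<and>
            (AE \<omega> in M. Z t \<omega> = real_cond_exp M (F (ennreal t)) Y \<omega>)) \<and>
     (AE \<omega> in M. continuous_on {0..} (\<lambda>t. Z t \<omega>))"

text \<open>
  The value \<open>inf\<^sub>\<tau> E[G (Z\<^sub>\<tau>) + c \<tau>]\<close>. For the gains used below the costs are nonnegative (posteriors lie in \<open>[0, 1]\<close> almost surely), so expectations are taken in
  \<^typ>\<open>ennreal\<close>: a stopping time with \<open>E[\<tau>] = \<infinity>\<close> has infinite cost, whereas the Bochner integral
  would give it the value 0. The value of \<^const>\<open>enn2real\<close> at \<open>\<infinity>\<close> is used on a null set only.
\<close>

definition optimal_stopping_value ::
    "'a measure \<Rightarrow> (ennreal \<Rightarrow> 'a measure) \<Rightarrow> (real \<Rightarrow> 'a \<Rightarrow> 'b) \<Rightarrow> ('b \<Rightarrow> real) \<Rightarrow> real \<Rightarrow> ennreal" where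
  "optimal_stopping_value M F Z G c =
     (INF \<tau> \<in> {\<tau>. stopping_time F \<tau> \<and> (AE \<omega> in M. \<tau> \<omega> < \<infinity>)}.
        \<integral>\<^sup>+ \<omega>. (ennreal (G (Z (enn2real (\<tau> \<omega>)) \<omega>)) + ennreal c * \<tau> \<omega>) \<partial>M)"

definition filtration1 ::
    "real \<Rightarrow> (real \<Rightarrow> 'a measure) \<Rightarrow> ('a \<Rightarrow> real) \<Rightarrow> (real \<Rightarrow> 'a \<Rightarrow> real) \<Rightarrow>
     real \<Rightarrow> ennreal \<Rightarrow> 'a measure" where
  "filtration1 \<mu> P Y W p = natural_filtration (space (P p)) (observation \<mu> Y W)"

text \<open>\<open>P p\<close> is the law \<open>P\<^sub>\<pi>\<close> with prior \<open>\<pi> = p\<close>; the posterior process \<open>Z p\<close> depends on the prior.\<close>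

definition testing_model1 ::
    "real \<Rightarrow> (real \<Rightarrow> 'a measure) \<Rightarrow> ('a \<Rightarrow> real) \<Rightarrow> (real \<Rightarrow> 'a \<Rightarrow> real) \<Rightarrow>
     (real \<Rightarrow> real \<Rightarrow> 'a \<Rightarrow> real) \<Rightarrow> bool" where
  "testing_model1 \<mu> P Y W Z \<longleftrightarrow>
     (\<forall>p\<in>{0..1}.
        prob_space (P p) \<and>
        bernoulli_rv (P p) p Y \<and>
        standard_brownian_motion (P p) W \<and>
        prob_space.indep_set (P p)
          (sets (vimage_algebra (space (P p)) Y borel))
          (sets (natural_filtration (space (P p)) W \<infinity>)) \<and>
        posterior_process (P p) (filtration1 \<mu> P Y W p) Y (Z p))"

definition value1 ::
    "real \<Rightarrow> real \<Rightarrow> (real \<Rightarrow> 'a measure) \<Rightarrow> ('a \<Rightarrow> real) \<Rightarrow> (real \<Rightarrow> 'a \<Rightarrow> real) \<Rightarrow>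
     (real \<Rightarrow> real \<Rightarrow> 'a \<Rightarrow> real) \<Rightarrow> real \<Rightarrow> ennreal" where
  "value1 \<mu> c P Y W Z p =
     optimal_stopping_value (P p) (filtration1 \<mu> P Y W p) (Z p) (\<lambda>x. min x (1 - x)) c"

definition continuation_region1 ::
    "real \<Rightarrow> real \<Rightarrow> (real \<Rightarrow> 'a measure) \<Rightarrow> ('a \<Rightarrow> real) \<Rightarrow> (real \<Rightarrow> 'a \<Rightarrow> real) \<Rightarrow>
     (real \<Rightarrow> real \<Rightarrow> 'a \<Rightarrow> real) \<Rightarrow> real set" where
  "continuation_region1 \<mu> c P Y W Z =
     {p \<in> {0..1}. value1 \<mu> c P Y W Z p < ennreal (min p (1 - p))}"

definition g :: "real \<times> real \<Rightarrow> real" where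
  "g = (\<lambda>(p1, p2). min (min p1 (1 - p1)) (min p2 (1 - p2)))"

definition filtration2 ::
    "real \<Rightarrow> real \<Rightarrow> (real \<times> real \<Rightarrow> 'a measure) \<Rightarrow> ('a \<Rightarrow> real) \<Rightarrow> ('a \<Rightarrow> real) \<Rightarrow>
     (real \<Rightarrow> 'a \<Rightarrow> real) \<Rightarrow> (real \<Rightarrow> 'a \<Rightarrow> real) \<Rightarrow> real \<times> real \<Rightarrow> ennreal \<Rightarrow> 'a measure" where
  "filtration2 \<mu>1 \<mu>2 P Y1 Y2 W1 W2 p =
     natural_filtration (space (P p))
       (\<lambda>t \<omega>. (observation \<mu>1 Y1 W1 t \<omega>, observation \<mu>2 Y2 W2 t \<omega>))"

definition testing_model2 ::
    "real \<Rightarrow> real \<Rightarrow> (real \<times> real \<Rightarrow> 'a measure) \<Rightarrow> ('a \<Rightarrow> real) \<Rightarrow> ('a \<Rightarrow> real) \<Rightarrow>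
     (real \<Rightarrow> 'a \<Rightarrow> real) \<Rightarrow> (real \<Rightarrow> 'a \<Rightarrow> real) \<Rightarrow>
     (real \<times> real \<Rightarrow> real \<Rightarrow> 'a \<Rightarrow> real \<times> real) \<Rightarrow> bool" where
  "testing_model2 \<mu>1 \<mu>2 P Y1 Y2 W1 W2 Z \<longleftrightarrow>
     (\<forall>p\<in>{0..1} \<times> {0..1}.
        prob_space (P p) \<and>
        bernoulli_rv (P p) (fst p) Y1 \<and>
        bernoulli_rv (P p) (snd p) Y2 \<and>
        standard_brownian_motion (P p) W1 \<and>
        standard_brownian_motion (P p) W2 \<and>
        prob_space.indep_sets (P p)
          (\<lambda>k. [sets (vimage_algebra (space (P p)) Y1 borel),
                sets (vimage_algebra (space (P p)) Y2 borel),
                sets (natural_filtration (space (P p)) W1 \<infinity>),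
                sets (natural_filtration (space (P p)) W2 \<infinity>)] ! k) {..<4} \<and>
        posterior_process (P p) (filtration2 \<mu>1 \<mu>2 P Y1 Y2 W1 W2 p) Y1 (\<lambda>t \<omega>. fst (Z p t \<omega>)) \<and>
        posterior_process (P p) (filtration2 \<mu>1 \<mu>2 P Y1 Y2 W1 W2 p) Y2 (\<lambda>t \<omega>. snd (Z p t \<omega>)))"

definition value2 ::
    "real \<Rightarrow> real \<Rightarrow> real \<Rightarrow> (real \<times> real \<Rightarrow> 'a measure) \<Rightarrow> ('a \<Rightarrow> real) \<Rightarrow> ('a \<Rightarrow> real) \<Rightarrow>
     (real \<Rightarrow> 'a \<Rightarrow> real) \<Rightarrow> (real \<Rightarrow> 'a \<Rightarrow> real) \<Rightarrow>
     (real \<times> real \<Rightarrow> real \<Rightarrow> 'a \<Rightarrow> real \<times> real) \<Rightarrow> real \<times> real \<Rightarrow> ennreal" where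
  "value2 \<mu>1 \<mu>2 c P Y1 Y2 W1 W2 Z p =
     optimal_stopping_value (P p) (filtration2 \<mu>1 \<mu>2 P Y1 Y2 W1 W2 p) (Z p) g c"

definition continuation_region2 ::
    "real \<Rightarrow> real \<Rightarrow> real \<Rightarrow> (real \<times> real \<Rightarrow> 'a measure) \<Rightarrow> ('a \<Rightarrow> real) \<Rightarrow> ('a \<Rightarrow> real) \<Rightarrow>
     (real \<Rightarrow> 'a \<Rightarrow> real) \<Rightarrow> (real \<Rightarrow> 'a \<Rightarrow> real) \<Rightarrow>
     (real \<times> real \<Rightarrow> real \<Rightarrow> 'a \<Rightarrow> real \<times> real) \<Rightarrow> (real \<times> real) set" where
  "continuation_region2 \<mu>1 \<mu>2 c P Y1 Y2 W1 W2 Z =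
     {p \<in> {0..1} \<times> {0..1}. value2 \<mu>1 \<mu>2 c P Y1 Y2 W1 W2 Z p < ennreal (g p)}"

end

(*
  On the rectangle, g(x, y) equals min x (1 - x) or min y (1 - y), and g never exceeds either, so it
  suffices that the two-dimensional value is at most each one-dimensional value. A one-dimensional
  stopping time is rounded up to a grid k/m, so that it becomes a rule on the path of the
  observation that can be replayed on the two-dimensional space, where the prior and the Wiener
  measure give that observation and the hypothesis the same joint law. For the terminal cost no
  formula for the posterior is needed: the expectation of min Z (1 - Z) is the error probability of
  the best decision, which the additional information in the second coordinate can only lower.
  Letting m tend to infinity and using path continuity removes the grid.
*)

theory Submission
  imports Defs
begin

text \<open>The models live on different probability spaces and no map between them is assumed, so
  only laws can be compared. The filtrations are generated by the observations alone, without added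
  null sets or right limits. Hence an event known at a fixed time is exactly a set of paths up to
  that time, and this set can be pulled back along any other observation. A general stopping time
  involves uncountably many such events, and the posterior is tied to the conditional expectation
  only up to a null set at each time; a grid leaves countably many of both. Rounding up rather than
  down keeps the result a stopping time and costs at most \<open>c / m\<close>. The limit in m is
  taken only in the one-dimensional model. In the two-dimensional one each m supplies an admissible
  time, hence an upper bound for the value, and nothing has to converge there.\<close>

section \<open>Natural filtrations and events of paths\<close>

lemma space_natural_filtration [simp]: "space (natural_filtration \<Omega> X t) = \<Omega>"
  by (auto simp: natural_filtration_def intro!: space_measure_of)

lemma sets_natural_filtration:
  "sets (natural_filtration \<Omega> X t) =
     sigma_sets \<Omega> {X s -` B \<inter> \<Omega> | s B. 0 \<le> s \<and> ennreal s \<le> t \<and> B \<in> sets borel}"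
  by (auto simp: natural_filtration_def intro!: sets_measure_of)

lemma measurable_natural_filtration_component:
  assumes "0 \<le> s" "ennreal s \<le> t"
  shows "X s \<in> borel_measurable (natural_filtration \<Omega> X t)"
  unfolding measurable_def sets_natural_filtration using assms by auto

lemma measurable_natural_filtrationI:
  assumes "\<And>s. 0 \<le> s \<Longrightarrow> ennreal s \<le> t \<Longrightarrow> (\<lambda>\<omega>. X s (f \<omega>)) \<in> borel_measurable M"
    and "\<And>\<omega>. \<omega> \<in> space M \<Longrightarrow> f \<omega> \<in> \<Omega>"
  shows "f \<in> M \<rightarrow>\<^sub>M natural_filtration \<Omega> X t"
  unfolding natural_filtration_def
proof (rule measurable_measure_of)
  fix A assume "A \<in> {X s -` B \<inter> \<Omega> | s B. 0 \<le> s \<and> ennreal s \<le> t \<and> B \<in> sets borel}"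
  then obtain s B where s: "0 \<le> s" "ennreal s \<le> t" "B \<in> sets borel" "A = X s -` B \<inter> \<Omega>"
    by auto
  have "f -` A \<inter> space M = (\<lambda>\<omega>. X s (f \<omega>)) -` B \<inter> space M"
    using assms(2) s by auto
  then show "f -` A \<inter> space M \<in> sets M"
    using measurable_sets[OF assms(1)] s by metis
qed (use assms(2) in auto)

lemma natural_filtration_mono:
  assumes "s \<le> t"
  shows "sets (natural_filtration \<Omega> X s) \<subseteq> sets (natural_filtration \<Omega> X t)"
  unfolding sets_natural_filtration
  by (rule sigma_sets_mono') (use assms in \<open>force intro: order_trans\<close>)

lemma subalgebra_natural_filtration:
  assumes "\<And>s. 0 \<le> s \<Longrightarrow> X s \<in> borel_measurable M"
  shows "subalgebra M (natural_filtration (space M) X t)"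
proof -
  have "(\<lambda>\<omega>. \<omega>) \<in> M \<rightarrow>\<^sub>M natural_filtration (space M) X t"
    by (rule measurable_natural_filtrationI) (use assms in auto)
  from measurable_sets[OF this] sets.sets_into_space[of _ "natural_filtration (space M) X t"]
  show ?thesis unfolding subalgebra_def
    by (auto simp: Int_absorb2)
qed

text \<open>Paths are arbitrary functions, since Brownian paths are continuous only almost surely;
  the sigma-algebra sees only the values at nonnegative times up to its index.\<close>

abbreviation path_algebra :: "ennreal \<Rightarrow> (real \<Rightarrow> real) measure" where
  "path_algebra \<equiv> natural_filtration UNIV (\<lambda>s x. x s)"

lemma measurable_path_algebraI:
  assumes "\<And>s. 0 \<le> s \<Longrightarrow> ennreal s \<le> t \<Longrightarrow> X s \<in> borel_measurable M"
  shows "(\<lambda>\<omega> s. X s \<omega>) \<in> M \<rightarrow>\<^sub>M path_algebra t"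
  by (rule measurable_natural_filtrationI) (use assms in auto)

lemma measurable_path_natural_filtration:
  fixes X :: "real \<Rightarrow> 'a \<Rightarrow> real"
  shows "(\<lambda>\<omega> s. X s \<omega>) \<in> natural_filtration \<Omega> X t \<rightarrow>\<^sub>M path_algebra t"
  by (rule measurable_path_algebraI) (rule measurable_natural_filtration_component)

lemma natural_filtration_path_set:
  fixes X :: "real \<Rightarrow> 'a \<Rightarrow> real"
  assumes "E \<in> sets (natural_filtration \<Omega> X t)"
  obtains B where "B \<in> sets (path_algebra t)" "E = {\<omega> \<in> \<Omega>. (\<lambda>s. X s \<omega>) \<in> B}"
proof -
  define G where "G = {(\<lambda>x. x s) -` B \<inter> UNIV | s (B :: real set).
      0 \<le> (s::real) \<and> ennreal s \<le> t \<and> B \<in> sets borel}"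
  let ?f = "\<lambda>\<omega> s. X s \<omega>"
  have "E \<in> sigma_sets \<Omega> {?f -` A \<inter> \<Omega> | A. A \<in> G}"
  proof (rule subsetD[OF sigma_sets_mono', rotated])
    show "E \<in> sigma_sets \<Omega> {X s -` B \<inter> \<Omega> | s B. 0 \<le> s \<and> ennreal s \<le> t \<and> B \<in> sets borel}"
      using assms unfolding sets_natural_filtration .
    show "{X s -` B \<inter> \<Omega> | s B. 0 \<le> s \<and> ennreal s \<le> t \<and> B \<in> sets borel} \<subseteq>
        {?f -` A \<inter> \<Omega> | A. A \<in> G}"
    proof safe
      fix s :: real and B :: "real set" assume s: "0 \<le> s" "ennreal s \<le> t" "B \<in> sets borel"
      show "\<exists>A. X s -` B \<inter> \<Omega> = ?f -` A \<inter> \<Omega> \<and> A \<in> G"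
        unfolding G_def using s by (intro exI[of _ "(\<lambda>x. x s) -` B \<inter> UNIV"]) auto
    qed
  qed
  also have "\<dots> = {?f -` A \<inter> \<Omega> | A. A \<in> sigma_sets UNIV G}"
    by (rule sigma_sets_vimage_commute[symmetric]) auto
  finally show ?thesis
    using that unfolding sets_natural_filtration G_def by auto
qed

section \<open>Uniqueness of Wiener measure\<close>

lemma finite_time_grid:
  assumes "finite J" "J \<subseteq> {0..}"
  obtains n and ts :: "nat \<Rightarrow> real" and idx where "0 < n" "ts 0 = 0"
    "\<And>k. k < n \<Longrightarrow> ts k < ts (Suc k)" "\<And>s. s \<in> J \<Longrightarrow> idx s \<le> n \<and> ts (idx s) = s"
proof -
  \<comment> \<open>\<open>0\<close> makes the increments start at the origin of the motion.
    \<open>1\<close> guarantees two grid points and so \<open>0 < n\<close>, even if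
    \<open>J\<close> is empty or just \<open>{0}\<close>.\<close>
  define T where "T = insert 0 (insert 1 J)"
  define xs where "xs = sorted_list_of_set T"
  have T: "finite T" "set xs = T" "sorted_wrt (<) xs" "length xs = card T"
    using assms by (simp_all add: T_def xs_def del: sorted_list_of_set_insert_remove)
  have "card {0, 1 :: real} \<le> card T"
    using assms by (intro card_mono) (auto simp: T_def)
  then have len: "2 \<le> length xs" using T by simp
  have "\<exists>i. i < length xs \<and> xs ! i = 0"
    using T(2) by (metis T_def in_set_conv_nth insertI1)
  then obtain i where i: "i < length xs" "xs ! i = 0" by auto
  have "xs ! 0 \<in> T" using len T(2) by (metis nth_mem order_less_le_trans zero_less_numeral)
  then have "0 \<le> xs ! 0" using assms by (auto simp: T_def)
  moreover have "xs ! 0 < 0" if "0 < i"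
    using sorted_wrt_nth_less[OF T(3) that i(1)] i(2) by simp
  ultimately have "xs ! 0 = 0" using i by (cases "i = 0") auto
  moreover have "\<forall>s\<in>J. \<exists>k. k \<le> length xs - 1 \<and> xs ! k = s"
  proof
    fix s assume "s \<in> J"
    then have "s \<in> set xs" by (simp add: T T_def)
    then obtain k where "k < length xs" "xs ! k = s" by (auto simp: in_set_conv_nth)
    then show "\<exists>k. k \<le> length xs - 1 \<and> xs ! k = s" by (intro exI[of _ k]) auto
  qed
  then obtain idx where "\<forall>s\<in>J. idx s \<le> length xs - 1 \<and> xs ! idx s = s" by metis
  moreover have "xs ! k < xs ! Suc k" if "k < length xs - 1" for k
    by (rule sorted_wrt_nth_less[OF T(3)]) (use that in auto)
  ultimately show ?thesis using that[of "length xs - 1" "\<lambda>k. xs ! k" idx] len by auto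
qed

text \<open>Each value of the motion is a partial sum of independent Gaussian increments. The
  right-hand side depends on the times and the sets but not on \<open>W\<close>, so two motions on
  different spaces can be compared through it.\<close>

lemma (in prob_space) brownian_finite_dimensional_law:
  fixes ts :: "nat \<Rightarrow> real"
  assumes W: "standard_brownian_motion M W"
    and ts: "0 < n" "ts 0 = 0" "\<And>k. k < n \<Longrightarrow> ts k < ts (Suc k)"
    and J: "finite J" "\<And>s. s \<in> J \<Longrightarrow> idx s \<le> n \<and> ts (idx s) = s"
    and A: "\<And>s. s \<in> J \<Longrightarrow> A s \<in> sets borel"
  defines "N \<equiv> \<lambda>k. density lborel (\<lambda>x. ennreal (normal_density 0 (sqrt (ts (Suc k) - ts k)) x))"
  shows "emeasure M {\<omega> \<in> space M. \<forall>s\<in>J. W s \<omega> \<in> A s} =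
    emeasure (PiM {..<n} N)
      {v \<in> space (PiM {..<n} (\<lambda>_. borel)). \<forall>s\<in>J. (\<Sum>k<idx s. v k) \<in> A s}" (is "_ = emeasure _ ?S")
proof -
  let ?inc = "\<lambda>k \<omega>. W (ts (Suc k)) \<omega> - W (ts k) \<omega>"
  have nonneg: "0 \<le> ts k" if "k \<le> n" for k
    using that by (induction k) (use ts in \<open>auto intro: less_imp_le order_trans simp: Suc_le_eq\<close>)
  have meas [measurable]: "W (ts k) \<in> borel_measurable M" if "k \<le> n" for k
    using W nonneg[OF that] by (auto simp: standard_brownian_motion_def)
  have inc [measurable]: "?inc k \<in> borel_measurable M" if "k < n" for k
    using that by (intro borel_measurable_diff meas) auto
  have indep: "indep_vars (\<lambda>_. borel) ?inc {..<n}"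
    using W ts by (auto simp: standard_brownian_motion_def)
  have distr: "distr M borel (?inc k) = N k" if "k < n" for k
  proof -
    have "distributed M lborel (?inc k) (normal_density 0 (sqrt (ts (Suc k) - ts k)))"
      using W ts(3)[OF that] nonneg[of k] that by (auto simp: standard_brownian_motion_def)
    then have "distr M lborel (?inc k) = N k" by (simp add: distributed_def N_def)
    moreover have "distr M borel (?inc k) = distr M lborel (?inc k)"
      by (rule distr_cong) auto
    ultimately show ?thesis by simp
  qed
  have S: "?S \<in> sets (PiM {..<n} (\<lambda>_. borel))"
  proof -
    have [measurable]: "(\<lambda>v. \<Sum>k<idx s. v k) \<in> borel_measurable (PiM {..<n} (\<lambda>_. borel :: real measure))"
      if "s \<in> J" for s
      using J(2)[OF that] by (intro borel_measurable_sum measurable_component_singleton) auto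
    show ?thesis using J(1) A
      by (intro sets.sets_Collect_finite_All) (auto intro!: measurable_sets_Collect)
  qed
  \<comment> \<open>The motion starts at 0 only almost surely, so telescoping identifies the two
    events only up to a null set.\<close>
  have "AE \<omega> in M. W 0 \<omega> = 0" using W by (simp add: standard_brownian_motion_def)
  then have "AE \<omega> in M. \<omega> \<in> {\<omega> \<in> space M. \<forall>s\<in>J. W s \<omega> \<in> A s} \<longleftrightarrow>
      \<omega> \<in> {\<omega> \<in> space M. \<forall>s\<in>J. (\<Sum>k<idx s. ?inc k \<omega>) \<in> A s}"
  proof (rule AE_mp, intro AE_I2 impI)
    fix \<omega> assume 0: "W 0 \<omega> = 0"
    have "(\<Sum>k<idx s. ?inc k \<omega>) = W s \<omega>" if "s \<in> J" for s
      using J(2)[OF that] ts(2) 0 by (simp add: sum_lessThan_telescope[of "\<lambda>k. W (ts k) \<omega>"])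
    then show "\<omega> \<in> {\<omega> \<in> space M. \<forall>s\<in>J. W s \<omega> \<in> A s} \<longleftrightarrow>
        \<omega> \<in> {\<omega> \<in> space M. \<forall>s\<in>J. (\<Sum>k<idx s. ?inc k \<omega>) \<in> A s}" by auto
  qed
  moreover have "{\<omega> \<in> space M. \<forall>s\<in>J. W s \<omega> \<in> A s} \<in> sets M"
  proof (intro sets.sets_Collect_finite_All J(1))
    fix s assume "s \<in> J"
    then have "W s \<in> borel_measurable M" using J(2)[of s] meas[of "idx s"] by auto
    then show "{\<omega> \<in> space M. W s \<omega> \<in> A s} \<in> events"
      using measurable_sets[OF _ A[OF \<open>s \<in> J\<close>], of "W s" M]
      by (simp add: vimage_def Int_def conj_commute)
  qed
  moreover have eq: "{\<omega> \<in> space M. \<forall>s\<in>J. (\<Sum>k<idx s. ?inc k \<omega>) \<in> A s} =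
      (\<lambda>\<omega>. \<lambda>k\<in>{..<n}. ?inc k \<omega>) -` ?S \<inter> space M"
  proof -
    have "(\<Sum>k<idx s. (\<lambda>k\<in>{..<n}. ?inc k \<omega>) k) = (\<Sum>k<idx s. ?inc k \<omega>)" if "s \<in> J" for s \<omega>
      using J(2)[OF that] by (intro sum.cong) auto
    then have "{\<omega> \<in> space M. \<forall>s\<in>J. (\<Sum>k<idx s. ?inc k \<omega>) \<in> A s} =
        {\<omega> \<in> space M. \<forall>s\<in>J. (\<Sum>k<idx s. (\<lambda>k\<in>{..<n}. ?inc k \<omega>) k) \<in> A s}"
      by (intro Collect_cong conj_cong ball_cong) (simp_all del: restrict_apply)
    then show ?thesis
      by (simp add: space_PiM vimage_def Int_def conj_commute del: restrict_apply)
  qed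
  moreover have vec: "(\<lambda>\<omega>. \<lambda>k\<in>{..<n}. ?inc k \<omega>) \<in> M \<rightarrow>\<^sub>M PiM {..<n} (\<lambda>_. borel)"
    by (intro measurable_restrict) auto
  ultimately have "emeasure M {\<omega> \<in> space M. \<forall>s\<in>J. W s \<omega> \<in> A s} =
      emeasure M ((\<lambda>\<omega>. \<lambda>k\<in>{..<n}. ?inc k \<omega>) -` ?S \<inter> space M)"
    using measurable_sets[OF vec S] by (intro emeasure_eq_AE) auto
  also have "\<dots> = emeasure (distr M (PiM {..<n} (\<lambda>_. borel)) (\<lambda>\<omega>. \<lambda>k\<in>{..<n}. ?inc k \<omega>)) ?S"
    by (rule emeasure_distr[OF vec S, symmetric])
  also have "distr M (PiM {..<n} (\<lambda>_. borel)) (\<lambda>\<omega>. \<lambda>k\<in>{..<n}. ?inc k \<omega>) =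
      PiM {..<n} (\<lambda>k. distr M borel (?inc k))"
    using indep ts(1) inc by (subst (asm) indep_vars_iff_distr_eq_PiM') auto
  also have "\<dots> = PiM {..<n} N"
    by (intro PiM_cong) (auto simp: distr)
  finally show ?thesis .
qed

text \<open>Pi-lambda argument: finite-dimensional cylinders are stable under intersection and
  generate the path algebra, and on each of them both laws are given by the same Gaussian product
  measure.\<close>

lemma brownian_law_unique:
  assumes M: "prob_space M" "standard_brownian_motion M W"
    and N: "prob_space N" "standard_brownian_motion N V"
  shows "distr M (path_algebra \<infinity>) (\<lambda>\<omega> s. W s \<omega>) = distr N (path_algebra \<infinity>) (\<lambda>\<omega> s. V s \<omega>)"
proof -
  define E where "E = {{x :: real \<Rightarrow> real. \<forall>s\<in>J. x s \<in> A s} | J A.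
      finite J \<and> J \<subseteq> {0..} \<and> (\<forall>s. A s \<in> sets borel)}"
  have W: "(\<lambda>\<omega> s. W s \<omega>) \<in> M \<rightarrow>\<^sub>M path_algebra \<infinity>"
    using M by (intro measurable_path_algebraI) (auto simp: standard_brownian_motion_def)
  have V: "(\<lambda>\<omega> s. V s \<omega>) \<in> N \<rightarrow>\<^sub>M path_algebra \<infinity>"
    using N by (intro measurable_path_algebraI) (auto simp: standard_brownian_motion_def)
  have cyl: "{x. \<forall>s\<in>J. x s \<in> A s} \<in> sets (path_algebra \<infinity>)"
    if "finite J" "J \<subseteq> {0..}" "\<And>s. A s \<in> sets borel" for J and A :: "real \<Rightarrow> real set"
  proof -
    have "{x \<in> space (path_algebra \<infinity>). x s \<in> A s} \<in> sets (path_algebra \<infinity>)" if "s \<in> J" for s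
      using \<open>J \<subseteq> {0..}\<close> that \<open>\<And>s. A s \<in> sets borel\<close>
      by (intro measurable_sets_Collect[OF measurable_natural_filtration_component[where X="\<lambda>s x. x s"]]) auto
    then have "{x \<in> space (path_algebra \<infinity>). \<forall>s\<in>J. x s \<in> A s} \<in> sets (path_algebra \<infinity>)"
      using \<open>finite J\<close> by (intro sets.sets_Collect_finite_All) auto
    then show ?thesis by simp
  qed
  have sets: "sets (path_algebra \<infinity>) = sigma_sets UNIV E"
  proof (rule equalityI)
    show "sets (path_algebra \<infinity>) \<subseteq> sigma_sets UNIV E"
      unfolding sets_natural_filtration
    proof (rule sigma_sets_mono', safe)
      fix s :: real and B :: "real set" assume "0 \<le> s" "B \<in> sets borel"
      then have "{x :: real \<Rightarrow> real. \<forall>s'\<in>{s}. x s' \<in> B} \<in> E"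
        unfolding E_def by (intro CollectI exI[of _ "{s}"] exI[of _ "\<lambda>_. B"]) auto
      then show "(\<lambda>x. x s) -` B \<inter> UNIV \<in> E" by (simp add: vimage_def)
    qed
    show "sigma_sets UNIV E \<subseteq> sets (path_algebra \<infinity>)"
      using sets.sigma_sets_subset[of E "path_algebra \<infinity>"] cyl by (auto simp: E_def)
  qed
  show ?thesis
  proof (rule measure_eqI_generator_eq[where \<Omega>=UNIV and E=E and A="\<lambda>_. UNIV"])
    show "Int_stable E"
    proof (rule Int_stableI)
      fix a b assume "a \<in> E" "b \<in> E"
      then obtain J A J' A' where a: "a = {x. \<forall>s\<in>J. x s \<in> A s}" "finite J" "J \<subseteq> {0..}" "\<And>s. A s \<in> sets borel"
        and b: "b = {x. \<forall>s\<in>J'. x s \<in> A' s}" "finite J'" "J' \<subseteq> {0..}" "\<And>s. A' s \<in> sets borel"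
        by (auto simp: E_def)
      \<comment> \<open>Padding with \<open>UNIV\<close> puts both cylinders over the common index
        set \<open>J \<union> J'\<close>.\<close>
      let ?A = "\<lambda>s. (if s \<in> J then A s else UNIV) \<inter> (if s \<in> J' then A' s else UNIV)"
      have "a \<inter> b = {x. \<forall>s\<in>J \<union> J'. x s \<in> ?A s}" unfolding a b by auto
      moreover have "\<forall>s. ?A s \<in> sets borel" using a b by auto
      ultimately show "a \<inter> b \<in> E" unfolding E_def using a b
        by (intro CollectI exI[of _ "J \<union> J'"] exI[of _ ?A]) auto
    qed
    show "emeasure (distr M (path_algebra \<infinity>) (\<lambda>\<omega> s. W s \<omega>)) X =
        emeasure (distr N (path_algebra \<infinity>) (\<lambda>\<omega> s. V s \<omega>)) X" if "X \<in> E" for X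
    proof -
      from that obtain J A where X: "X = {x. \<forall>s\<in>J. x s \<in> A s}" "finite J" "J \<subseteq> {0..}" "\<And>s. A s \<in> sets borel"
        by (auto simp: E_def)
      obtain n ts idx where ts: "0 < n" "ts 0 = 0"
        "\<And>k. k < n \<Longrightarrow> ts k < ts (Suc k)" "\<And>s. s \<in> J \<Longrightarrow> idx s \<le> n \<and> ts (idx s) = s"
        using finite_time_grid[OF X(2,3)] by metis
      have XW: "X \<in> sets (path_algebra \<infinity>)" unfolding X(1) by (rule cyl[OF X(2-4)])
      have "emeasure (distr M (path_algebra \<infinity>) (\<lambda>\<omega> s. W s \<omega>)) X =
          emeasure M {\<omega> \<in> space M. \<forall>s\<in>J. W s \<omega> \<in> A s}"
        unfolding emeasure_distr[OF W XW] by (rule arg_cong[where f="emeasure M"]) (auto simp: X(1))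
      also have "\<dots> = emeasure N {\<omega> \<in> space N. \<forall>s\<in>J. V s \<omega> \<in> A s}"
        using prob_space.brownian_finite_dimensional_law[OF M ts(1-3) X(2) ts(4), of A] X(4)
          prob_space.brownian_finite_dimensional_law[OF N ts(1-3) X(2) ts(4), of A] by simp
      also have "\<dots> = emeasure (distr N (path_algebra \<infinity>) (\<lambda>\<omega> s. V s \<omega>)) X"
        unfolding emeasure_distr[OF V XW] by (rule arg_cong[where f="emeasure N"]) (auto simp: X(1))
      finally show ?thesis .
    qed
    show "range (\<lambda>_. UNIV) \<subseteq> E"
      unfolding E_def by (auto intro!: exI[of _ "{}"])
    interpret prob_space M by fact
    show "emeasure (distr M (path_algebra \<infinity>) (\<lambda>\<omega> s. W s \<omega>)) UNIV \<noteq> \<infinity>" for i :: nat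
    proof -
      interpret D: prob_space "distr M (path_algebra \<infinity>) (\<lambda>\<omega> s. W s \<omega>)"
        by (rule prob_space_distr[OF W])
      show ?thesis using D.emeasure_finite[of UNIV] by simp
    qed
  qed (auto simp: sets[unfolded infinity_ennreal_def])
qed

section \<open>The law of the observations\<close>

text \<open>The common part of the one-dimensional model and of each coordinate of the
  two-dimensional one. Independence is stated event by event because \<open>indep_set\<close> and
  \<open>indep_sets\<close> both supply it in this form.\<close>

locale single_test = prob_space M for M :: "'a measure" +
  fixes p :: real and Y :: "'a \<Rightarrow> real" and W :: "real \<Rightarrow> 'a \<Rightarrow> real"
  assumes bernoulli: "bernoulli_rv M p Y"
    and brownian: "standard_brownian_motion M W"
    and indep: "\<And>a b. a \<in> sets (vimage_algebra (space M) Y borel) \<Longrightarrow>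
      b \<in> sets (natural_filtration (space M) W \<infinity>) \<Longrightarrow> prob (a \<inter> b) = prob a * prob b"
begin

lemma Y_measurable [measurable]: "Y \<in> borel_measurable M"
  using bernoulli by (simp add: bernoulli_rv_def)

lemma Y_cases: "\<omega> \<in> space M \<Longrightarrow> Y \<omega> = 0 \<or> Y \<omega> = 1"
  using bernoulli by (auto simp: bernoulli_rv_def)

lemma W_path_measurable: "(\<lambda>\<omega> s. W s \<omega>) \<in> M \<rightarrow>\<^sub>M path_algebra \<infinity>"
  using brownian by (intro measurable_path_algebraI) (auto simp: standard_brownian_motion_def)

lemma W_measurable: "0 \<le> s \<Longrightarrow> W s \<in> borel_measurable M"
  using brownian by (simp add: standard_brownian_motion_def)

lemma observation_measurable:
  assumes "0 \<le> s"
  shows "observation \<mu> Y W s \<in> borel_measurable M"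
proof -
  note [measurable] = W_measurable[OF assms]
  show ?thesis unfolding observation_def[abs_def] by measurable
qed

lemma subalgebra_observation: "subalgebra M (natural_filtration (space M) (observation \<mu> Y W) t)"
  by (intro subalgebra_natural_filtration observation_measurable)

lemma prob_Y: "emeasure M {\<omega> \<in> space M. Y \<omega> = 1} = ennreal p"
    "emeasure M {\<omega> \<in> space M. Y \<omega> = 0} = ennreal (1 - p)"
proof -
  have 1: "prob {\<omega> \<in> space M. Y \<omega> = 1} = p"
    using bernoulli by (simp add: bernoulli_rv_def)
  have "{\<omega> \<in> space M. Y \<omega> = 0} = space M - {\<omega> \<in> space M. Y \<omega> = 1}"
    using Y_cases by force
  then have "prob {\<omega> \<in> space M. Y \<omega> = 0} = 1 - p"
    using 1 by (simp add: prob_compl)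
  with 1 show "emeasure M {\<omega> \<in> space M. Y \<omega> = 1} = ennreal p"
    "emeasure M {\<omega> \<in> space M. Y \<omega> = 0} = ennreal (1 - p)"
    by (simp_all add: emeasure_eq_measure)
qed

text \<open>Split by the value of \<open>Y\<close>: on \<open>Y = y\<close> the observation is
  \<open>W\<close> with the deterministic drift \<open>\<mu> * y\<close>, and independence turns the
  joint law into a mixture of two drifted Wiener measures. \<open>Q\<close> is written through the
  law of \<open>W\<close> on path space so that uniqueness of this law can be applied by
  rewriting.\<close>

lemma observation_law:
  fixes \<mu> :: real
  assumes S: "S \<in> sets (borel \<Otimes>\<^sub>M path_algebra \<infinity>)"
  defines "Q \<equiv> \<lambda>y. emeasure (distr M (path_algebra \<infinity>) (\<lambda>\<omega> s. W s \<omega>))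
    {x. (y, \<lambda>s. \<mu> * y * s + x s) \<in> S}"
  shows "emeasure M {\<omega> \<in> space M. (Y \<omega>, \<lambda>s. observation \<mu> Y W s \<omega>) \<in> S} =
    ennreal (1 - p) * Q 0 + ennreal p * Q 1"
proof -
  let ?S = "\<lambda>y. {x. (y, \<lambda>s. \<mu> * y * s + x s) \<in> S}"
  let ?a = "\<lambda>y. {\<omega> \<in> space M. Y \<omega> = y}" and ?b = "\<lambda>y. {\<omega> \<in> space M. (\<lambda>s. W s \<omega>) \<in> ?S y}"
  have "(\<lambda>x. (y, \<lambda>s. \<mu> * y * s + x s)) \<in> path_algebra \<infinity> \<rightarrow>\<^sub>M borel \<Otimes>\<^sub>M path_algebra \<infinity>" for y
    by (intro measurable_Pair measurable_const measurable_path_algebraI borel_measurable_add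
        borel_measurable_const measurable_natural_filtration_component[where X="\<lambda>s x. x s"]) auto
  from measurable_sets[OF this S] have SP: "?S y \<in> sets (path_algebra \<infinity>)" for y
    by (simp add: vimage_def)
  have b: "?b y \<in> sets (natural_filtration (space M) W \<infinity>)" for y
    using measurable_sets[OF measurable_path_natural_filtration[of W "space M"] SP[of y]]
    by (simp add: vimage_def Int_def conj_commute)
  have a: "?a y \<in> sets (vimage_algebra (space M) Y borel)" for y
    using in_vimage_algebra[of "{y}" borel Y "space M"]
    by (simp add: vimage_def Int_def conj_commute)
  have bM: "?b y \<in> events" for y
    using measurable_sets[OF W_path_measurable SP[of y]] by (simp add: vimage_def Int_def conj_commute)
  have aM: "?a y \<in> events" for y by measurable
  have Q: "Q y = emeasure M (?b y)" for y
    unfolding Q_def emeasure_distr[OF W_path_measurable SP]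
    by (rule arg_cong[where f="emeasure M"]) auto
  have prod: "emeasure M (?a y \<inter> ?b y) = emeasure M (?a y) * Q y" for y
    unfolding Q using indep[OF a b, of y y] by (simp add: emeasure_eq_measure ennreal_mult)
  have split: "{\<omega> \<in> space M. (Y \<omega>, \<lambda>s. observation \<mu> Y W s \<omega>) \<in> S} = (?a 0 \<inter> ?b 0) \<union> (?a 1 \<inter> ?b 1)"
  proof (rule set_eqI)
    fix \<omega>
    show "\<omega> \<in> {\<omega> \<in> space M. (Y \<omega>, \<lambda>s. observation \<mu> Y W s \<omega>) \<in> S} \<longleftrightarrow>
        \<omega> \<in> (?a 0 \<inter> ?b 0) \<union> (?a 1 \<inter> ?b 1)"
      by (cases "\<omega> \<in> space M") (use Y_cases[of \<omega>] in \<open>auto simp: observation_def\<close>)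
  qed
  have "emeasure M ((?a 0 \<inter> ?b 0) \<union> (?a 1 \<inter> ?b 1)) = emeasure M (?a 0 \<inter> ?b 0) + emeasure M (?a 1 \<inter> ?b 1)"
    by (intro plus_emeasure[symmetric] sets.Int aM bM) auto
  then show ?thesis unfolding split prod prob_Y .
qed

end

lemma observation_law_unique:
  assumes "single_test M p Y W" "single_test N p Y' W'"
    and "S \<in> sets (borel \<Otimes>\<^sub>M path_algebra \<infinity>)"
  shows "emeasure M {\<omega> \<in> space M. (Y \<omega>, \<lambda>s. observation \<mu> Y W s \<omega>) \<in> S} =
    emeasure N {\<omega> \<in> space N. (Y' \<omega>, \<lambda>s. observation \<mu> Y' W' s \<omega>) \<in> S}"
proof -
  interpret M: single_test M p Y W by fact
  interpret N: single_test N p Y' W' by fact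
  show ?thesis
    unfolding M.observation_law[OF assms(3)] N.observation_law[OF assms(3)]
      brownian_law_unique[OF M.prob_space_axioms M.brownian N.prob_space_axioms N.brownian] ..
qed

section \<open>Decisions based on the posterior\<close>

text \<open>Read \<open>D\<close> as announcing \<open>Y = 1\<close> and \<open>E\<close> as
  stopping at time \<open>t\<close>. Given the information at \<open>t\<close>, announcing 1 is
  wrong with conditional probability \<open>1 - Z t\<close>, announcing 0 with \<open>Z t\<close>;
  integrated over events of the filtration these become true error probabilities. \<open>D\<close>
  is left arbitrary: on one space it will be the optimal decision, on the other a decision imported
  from there.\<close>

lemma (in prob_space) posterior_decision_error:
  assumes F: "\<And>t. subalgebra M (F t)" and Z: "posterior_process M F Y Z"
    and Y: "Y \<in> borel_measurable M" "\<And>\<omega>. \<omega> \<in> space M \<Longrightarrow> Y \<omega> = 0 \<or> Y \<omega> = 1"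
    and t: "0 \<le> t" and E: "E \<in> sets (F (ennreal t))" and D: "D \<in> sets (F (ennreal t))"
  shows "(\<integral>\<^sup>+\<omega>. ennreal (if \<omega> \<in> D then 1 - Z t \<omega> else Z t \<omega>) * indicator E \<omega> \<partial>M) =
       emeasure M {\<omega> \<in> E. (\<omega> \<in> D) \<noteq> (Y \<omega> = 1)}"
proof -
  interpret finite_measure_subalgebra M "F (ennreal t)"
    by unfold_locales (rule F)
  note [measurable] = Y(1)
  have int_Y: "integrable M Y"
    by (rule integrable_const_bound[where B=1]) (use Y in \<open>fastforce intro!: AE_I2\<close>)+
  have Zc: "AE \<omega> in M. Z t \<omega> = real_cond_exp M (F (ennreal t)) Y \<omega>"
    and "Z t \<in> borel_measurable (F (ennreal t))"
    using Z t by (auto simp: posterior_process_def)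
  then have Zm [measurable]: "Z t \<in> borel_measurable M"
    using measurable_from_subalg[OF F] by blast
  \<comment> \<open>The cost is integrated in \<open>ennreal\<close>, which cuts off negative
    values; these bounds make the passage to the Bochner integral exact.\<close>
  have Z01: "AE \<omega> in M. 0 \<le> Z t \<omega> \<and> Z t \<omega> \<le> 1"
  proof -
    have "AE \<omega> in M. 0 \<le> Y \<omega>" "AE \<omega> in M. Y \<omega> \<le> 1" using Y(2) by (force intro!: AE_I2)+
    from real_cond_exp_ge_c[OF int_Y this(1)] real_cond_exp_le_c[OF int_Y this(2)] Zc
    show ?thesis by eventually_elim auto
  qed
  have int_Z: "integrable M (Z t)"
    using Z01 by (intro integrable_const_bound[where B=1]) auto
  have FM: "A \<in> sets (F (ennreal t)) \<Longrightarrow> A \<in> events" for A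
    using F by (auto simp: subalgebra_def)
  have accept: "(\<integral>\<omega>. Z t \<omega> * indicator A \<omega> \<partial>M) = prob {\<omega> \<in> A. Y \<omega> = 1}"
    if A: "A \<in> sets (F (ennreal t))" for A
  proof -
    have [measurable]: "A \<in> events" by (rule FM[OF A])
    have "(\<integral>\<omega>. Z t \<omega> * indicator A \<omega> \<partial>M) =
        (\<integral>\<omega>. real_cond_exp M (F (ennreal t)) Y \<omega> * indicator A \<omega> \<partial>M)"
      using Zc by (intro integral_cong_AE) auto
    also have "\<dots> = (\<integral>\<omega>. Y \<omega> * indicator A \<omega> \<partial>M)"
      using real_cond_exp_intA[OF int_Y A] by (simp add: set_lebesgue_integral_def mult.commute)
    also have "\<dots> = (\<integral>\<omega>. indicator {\<omega> \<in> A. Y \<omega> = 1} \<omega> \<partial>M)"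
      using Y(2) by (intro Bochner_Integration.integral_cong) (auto split: split_indicator)
    also have "\<dots> = prob ({\<omega> \<in> A. Y \<omega> = 1} \<inter> space M)" by simp
    also have "{\<omega> \<in> A. Y \<omega> = 1} \<inter> space M = {\<omega> \<in> A. Y \<omega> = 1}"
      using sets.sets_into_space[OF FM[OF A]] by auto
    finally show ?thesis .
  qed
  let ?A = "E \<inter> D" and ?B = "E - D"
  have AB: "?A \<in> sets (F (ennreal t))" "?B \<in> sets (F (ennreal t))" using E D by auto
  have [measurable]: "E \<in> events" "D \<in> events" using FM E D by auto
  have sets: "{\<omega> \<in> A. P (Y \<omega>)} \<in> events" if "A \<in> events" "Measurable.pred borel P" for A P
  proof -
    note [measurable] = that
    have "{\<omega> \<in> space M. \<omega> \<in> A \<and> P (Y \<omega>)} \<in> events" by measurable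
    moreover have "{\<omega> \<in> A. P (Y \<omega>)} = {\<omega> \<in> space M. \<omega> \<in> A \<and> P (Y \<omega>)}"
      using sets.sets_into_space[OF that(1)] by auto
    ultimately show ?thesis by simp
  qed
  have "(\<integral>\<^sup>+\<omega>. ennreal (if \<omega> \<in> D then 1 - Z t \<omega> else Z t \<omega>) * indicator E \<omega> \<partial>M) =
      (\<integral>\<^sup>+\<omega>. ennreal ((1 - Z t \<omega>) * indicator ?A \<omega> + Z t \<omega> * indicator ?B \<omega>) \<partial>M)"
    by (intro nn_integral_cong) (auto split: split_indicator)
  also have "\<dots> = ennreal (\<integral>\<omega>. (1 - Z t \<omega>) * indicator ?A \<omega> + Z t \<omega> * indicator ?B \<omega> \<partial>M)"
    using Z01 int_Z by (intro nn_integral_eq_integral) (auto intro!: Bochner_Integration.integrable_add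
      integrable_real_mult_indicator simp: mult.commute split: split_indicator)
  also have "(\<integral>\<omega>. (1 - Z t \<omega>) * indicator ?A \<omega> + Z t \<omega> * indicator ?B \<omega> \<partial>M) =
      (\<integral>\<omega>. indicator ?A \<omega> \<partial>M) - (\<integral>\<omega>. Z t \<omega> * indicator ?A \<omega> \<partial>M) + (\<integral>\<omega>. Z t \<omega> * indicator ?B \<omega> \<partial>M)"
  proof -
    have "integrable M (\<lambda>\<omega>. Z t \<omega> * indicator A \<omega>)" if "A \<in> events" for A
      using that int_Z by (rule integrable_real_mult_indicator)
    moreover have "integrable M (indicator ?A :: 'a \<Rightarrow> real)"
      by (rule integrable_real_indicator) (auto simp: emeasure_eq_measure)
    ultimately show ?thesis
      using FM[OF AB(1)] FM[OF AB(2)]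
      by (simp add: left_diff_distrib del: Bochner_Integration.integral_indicator)
  qed
  also have "\<dots> = prob ?A - prob {\<omega> \<in> ?A. Y \<omega> = 1} + prob {\<omega> \<in> ?B. Y \<omega> = 1}"
    unfolding accept[OF AB(1)] accept[OF AB(2)] using sets.sets_into_space[OF FM[OF AB(1)]]
    by (simp add: Int_absorb2)
  also have "\<dots> = prob {\<omega> \<in> ?A. Y \<omega> \<noteq> 1} + prob {\<omega> \<in> ?B. Y \<omega> = 1}"
  proof -
    have "{\<omega> \<in> ?A. Y \<omega> \<noteq> 1} = ?A - {\<omega> \<in> ?A. Y \<omega> = 1}" by auto
    also have "prob \<dots> = prob ?A - prob {\<omega> \<in> ?A. Y \<omega> = 1}"
      using FM[OF AB(1)] by (intro finite_measure_Diff sets) auto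
    finally show ?thesis by simp
  qed
  also have "\<dots> = prob ({\<omega> \<in> ?A. Y \<omega> \<noteq> 1} \<union> {\<omega> \<in> ?B. Y \<omega> = 1})"
    using FM[OF AB(1)] FM[OF AB(2)] by (intro finite_measure_Union[symmetric] sets) auto
  also have "{\<omega> \<in> ?A. Y \<omega> \<noteq> 1} \<union> {\<omega> \<in> ?B. Y \<omega> = 1} = {\<omega> \<in> E. (\<omega> \<in> D) \<noteq> (Y \<omega> = 1)}"
    by auto
  finally show ?thesis by (simp add: emeasure_eq_measure)
qed

section \<open>Grid-valued hitting times\<close>

text \<open>The rule is encoded by a sequence of events instead of a rounded stopping time, so that
  the same path sets can define it on either space. The mesh is \<open>1 / m\<close>, and the events
  need not increase.\<close>

definition grid_hitting_time :: "nat \<Rightarrow> (nat \<Rightarrow> 'a set) \<Rightarrow> 'a \<Rightarrow> ennreal" where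
  "grid_hitting_time m E \<omega> =
     (if \<exists>k. \<omega> \<in> E k then ennreal (real (LEAST k. \<omega> \<in> E k) / real m) else \<infinity>)"

text \<open>The restriction to finite \<open>t\<close> matters: at \<open>\<infinity>\<close> the
  left side also holds when no event ever occurs.\<close>

lemma grid_hitting_time_le_iff:
  assumes "t < \<infinity>"
  shows "grid_hitting_time m E \<omega> \<le> t \<longleftrightarrow> (\<exists>k. \<omega> \<in> E k \<and> ennreal (real k / real m) \<le> t)"
proof
  assume "grid_hitting_time m E \<omega> \<le> t"
  with assms show "\<exists>k. \<omega> \<in> E k \<and> ennreal (real k / real m) \<le> t"
    by (auto simp: grid_hitting_time_def top.extremum_unique split: if_splits intro: LeastI)
next
  assume "\<exists>k. \<omega> \<in> E k \<and> ennreal (real k / real m) \<le> t"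
  then obtain k where k: "\<omega> \<in> E k" "ennreal (real k / real m) \<le> t" by auto
  have "(LEAST k. \<omega> \<in> E k) \<le> k" by (rule Least_le) (rule k(1))
  then have "ennreal (real (LEAST k. \<omega> \<in> E k) / real m) \<le> ennreal (real k / real m)"
    by (intro ennreal_leI divide_right_mono) auto
  with k show "grid_hitting_time m E \<omega> \<le> t"
    unfolding grid_hitting_time_def by (metis (mono_tags, lifting) order_trans)
qed

lemma stopping_time_grid_hitting_time:
  assumes space: "\<And>t. space (F t) = \<Omega>" and mono: "\<And>s t. s \<le> t \<Longrightarrow> sets (F s) \<subseteq> sets (F t)"
    and E: "\<And>k. E k \<in> sets (F (ennreal (real k / real m)))"
  shows "stopping_time F (grid_hitting_time m E)"
proof
  fix t
  show "Measurable.pred (F t) (\<lambda>\<omega>. grid_hitting_time m E \<omega> \<le> t)"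
  proof (cases "t < \<infinity>")
    case True
    have "{\<omega> \<in> space (F t). grid_hitting_time m E \<omega> \<le> t} =
        (\<Union>k\<in>{k. ennreal (real k / real m) \<le> t}. E k)"
      using sets.sets_into_space[OF E] by (auto simp: grid_hitting_time_le_iff[OF True] space)
    also have "\<dots> \<in> sets (F t)"
      using E mono by (intro sets.countable_UN') auto
    finally show ?thesis by (simp add: Measurable.pred_def)
  next
    case False
    then have "t = \<infinity>" using top.not_eq_extremum[of t] by auto
    then show ?thesis by simp
  qed
qed

lemma mem_disjointed_iff_Least:
  assumes "\<omega> \<in> E k"
  shows "\<omega> \<in> disjointed E j \<longleftrightarrow> j = (LEAST k. \<omega> \<in> E k)"
proof -
  have "\<omega> \<in> disjointed E j \<longleftrightarrow> \<omega> \<in> E j \<and> (\<forall>i<j. \<omega> \<notin> E i)"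
    by (auto simp: disjointed_def)
  also have "\<dots> \<longleftrightarrow> j = (LEAST k. \<omega> \<in> E k)"
  proof
    assume "\<omega> \<in> E j \<and> (\<forall>i<j. \<omega> \<notin> E i)"
    then show "j = (LEAST k. \<omega> \<in> E k)"
      by (metis (mono_tags, lifting) Least_equality not_less)
  next
    assume "j = (LEAST k. \<omega> \<in> E k)"
    then show "\<omega> \<in> E j \<and> (\<forall>i<j. \<omega> \<notin> E i)"
      using LeastI[of "\<lambda>k. \<omega> \<in> E k", OF assms] not_less_Least[of _ "\<lambda>k. \<omega> \<in> E k"] by blast
  qed
  finally show ?thesis .
qed

text \<open>The sets \<open>disjointed E k\<close> are the events of stopping exactly at
  \<open>k / m\<close>, so the cost becomes a series of costs at fixed times. Off their union the
  series is 0 while the left integrand is \<open>f 0 \<omega> + c * \<infinity>\<close>; this is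
  where \<open>fin\<close> enters.\<close>

lemma nn_integral_grid_hitting_time:
  fixes f :: "real \<Rightarrow> 'a \<Rightarrow> ennreal"
  assumes E: "\<And>k. E k \<in> sets M" and fin: "AE \<omega> in M. \<exists>k. \<omega> \<in> E k"
    and f: "\<And>t. 0 \<le> t \<Longrightarrow> f t \<in> borel_measurable M"
  shows "(\<integral>\<^sup>+\<omega>. f (enn2real (grid_hitting_time m E \<omega>)) \<omega> + c * grid_hitting_time m E \<omega> \<partial>M) =
    (\<Sum>k. (\<integral>\<^sup>+\<omega>. f (real k / real m) \<omega> * indicator (disjointed E k) \<omega> \<partial>M) +
      c * ennreal (real k / real m) * emeasure M (disjointed E k))"
proof -
  have f' [measurable]: "f (real k / real m) \<in> borel_measurable M" for k by (rule f) simp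
  have [measurable]: "disjointed E k \<in> sets M" for k
    using sets.range_disjointed_sets[of E M] E by auto
  let ?h = "\<lambda>k \<omega>. f (real k / real m) \<omega> * indicator (disjointed E k) \<omega> +
      c * ennreal (real k / real m) * indicator (disjointed E k) \<omega>"
  have "(\<integral>\<^sup>+\<omega>. f (enn2real (grid_hitting_time m E \<omega>)) \<omega> + c * grid_hitting_time m E \<omega> \<partial>M) =
      (\<integral>\<^sup>+\<omega>. (\<Sum>k. ?h k \<omega>) \<partial>M)"
  proof (rule nn_integral_cong_AE, use fin in eventually_elim)
    fix \<omega> assume "\<exists>k. \<omega> \<in> E k"
    then obtain k where k: "\<omega> \<in> E k" ..
    let ?k = "LEAST k. \<omega> \<in> E k"
    have "?h j \<omega> = (if j = ?k then f (real j / real m) \<omega> + c * ennreal (real j / real m) else 0)" for j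
      using mem_disjointed_iff_Least[of \<omega> E k j, OF k] by (auto split: split_indicator)
    then have "(\<Sum>j. ?h j \<omega>) = f (real ?k / real m) \<omega> + c * ennreal (real ?k / real m)"
      by (simp add: sums_unique[OF sums_single, symmetric])
    with k show "f (enn2real (grid_hitting_time m E \<omega>)) \<omega> + c * grid_hitting_time m E \<omega> = (\<Sum>j. ?h j \<omega>)"
      by (auto simp: grid_hitting_time_def)
  qed
  also have "\<dots> = (\<Sum>k. \<integral>\<^sup>+\<omega>. ?h k \<omega> \<partial>M)"
    by (rule nn_integral_suminf) measurable
  also have "\<dots> = (\<Sum>k. (\<integral>\<^sup>+\<omega>. f (real k / real m) \<omega> * indicator (disjointed E k) \<omega> \<partial>M) +
      c * ennreal (real k / real m) * emeasure M (disjointed E k))"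
    by (intro suminf_cong) (simp add: nn_integral_add nn_integral_cmult_indicator)
  finally show ?thesis .
qed

text \<open>The time takes only countably many values, so measurability of \<open>f\<close> at each
  fixed time carries over to the random time.\<close>

lemma borel_measurable_grid_hitting_time:
  fixes f :: "real \<Rightarrow> 'a \<Rightarrow> ennreal"
  assumes E: "\<And>k. E k \<in> sets M" and f: "\<And>t. 0 \<le> t \<Longrightarrow> f t \<in> borel_measurable M"
  shows "(\<lambda>\<omega>. f (enn2real (grid_hitting_time m E \<omega>)) \<omega> + c * grid_hitting_time m E \<omega>) \<in> borel_measurable M"
proof -
  note [measurable] = E
  have [measurable]: "f 0 \<in> borel_measurable M" by (rule f) simp
  let ?k = "\<lambda>\<omega>. LEAST k. \<omega> \<in> E k"
  have k [measurable]: "?k \<in> M \<rightarrow>\<^sub>M count_space UNIV"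
    by (intro measurable_Least) measurable
  have [measurable]: "(\<lambda>\<omega>. f (real (?k \<omega>) / real m) \<omega>) \<in> borel_measurable M"
    by (rule measurable_compose_countable[where g="?k" and f="\<lambda>k. f (real k / real m)", OF f k]) simp
  \<comment> \<open>If no event occurs the time is \<open>\<infinity>\<close>, which
    \<open>enn2real\<close> sends to 0: hence \<open>f 0\<close> in the last branch.\<close>
  have eq: "f (enn2real (grid_hitting_time m E \<omega>)) \<omega> + c * grid_hitting_time m E \<omega> =
      (if \<exists>k. \<omega> \<in> E k then f (real (?k \<omega>) / real m) \<omega> + c * ennreal (real (?k \<omega>) / real m)
       else f 0 \<omega> + c * \<infinity>)" for \<omega>
    by (simp add: grid_hitting_time_def)
  show ?thesis unfolding eq by measurable
qed

section \<open>Transfer of stopping rules\<close>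

text \<open>\<open>M\<close> is the one-dimensional model; \<open>N\<close> will be the
  two-dimensional one seen through one coordinate. \<open>F'\<close> may carry more information than
  that coordinate, and \<open>Z'\<close> is the posterior given all of it. The two spaces are linked
  only through the common prior \<open>p\<close> and the common \<open>\<mu>\<close>.\<close>

locale test_embedding =
  M: single_test M p Y W + N: single_test N p Y' W'
  for M :: "'a measure" and p :: real and Y W and N :: "'b measure" and Y' W' +
  fixes \<mu> :: real and Z :: "real \<Rightarrow> 'a \<Rightarrow> real" and Z' :: "real \<Rightarrow> 'b \<Rightarrow> real"
    and F' :: "ennreal \<Rightarrow> 'b measure"
  assumes posterior: "posterior_process M (natural_filtration (space M) (observation \<mu> Y W)) Y Z"
    and posterior': "posterior_process N F' Y' Z'"
    and subalgebra': "\<And>t. subalgebra N (F' t)"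
    and mono': "\<And>s t. s \<le> t \<Longrightarrow> sets (F' s) \<subseteq> sets (F' t)"
    and adapted': "\<And>s t. 0 \<le> s \<Longrightarrow> ennreal s \<le> t \<Longrightarrow>
      observation \<mu> Y' W' s \<in> borel_measurable (F' t)"
begin

abbreviation F :: "ennreal \<Rightarrow> 'a measure" where
  "F \<equiv> natural_filtration (space M) (observation \<mu> Y W)"

lemma Z_measurable: "0 \<le> t \<Longrightarrow> Z t \<in> borel_measurable (F (ennreal t))"
  using posterior by (simp add: posterior_process_def)

lemma Z_measurable_M: "0 \<le> t \<Longrightarrow> Z t \<in> borel_measurable M"
  by (rule measurable_from_subalg[OF M.subalgebra_observation Z_measurable])

lemma Z'_measurable_N: "0 \<le> t \<Longrightarrow> Z' t \<in> borel_measurable N"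
  using posterior' measurable_from_subalg[OF subalgebra'] by (auto simp: posterior_process_def)

lemma observation_law_eq:
  assumes "S \<in> sets (borel \<Otimes>\<^sub>M path_algebra \<infinity>)"
  shows "emeasure N {\<omega> \<in> space N. (Y' \<omega>, \<lambda>s. observation \<mu> Y' W' s \<omega>) \<in> S} =
    emeasure M {\<omega> \<in> space M. (Y \<omega>, \<lambda>s. observation \<mu> Y W s \<omega>) \<in> S}"
  by (rule observation_law_unique[OF N.single_test_axioms M.single_test_axioms assms])

text \<open>A rule based on the path of the observation and the decision whether \<open>Z \<ge> 1 / 2\<close> are
  replayed on \<open>N\<close>, where they err with the same probability, while deciding according to the
  posterior \<open>Z'\<close> errs at most as often because \<open>F'\<close> carries at least as much information.\<close>

lemma optimal_stopping_value_le_grid: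
  assumes G: "\<And>t \<omega>. G (V t \<omega>) \<le> min (Z' t \<omega>) (1 - Z' t \<omega>)"
    and E: "\<And>k. E k \<in> sets (F (ennreal (real k / real m)))"
    and fin: "AE \<omega> in M. \<exists>k. \<omega> \<in> E k"
  shows "optimal_stopping_value N F' V G c \<le>
    (\<integral>\<^sup>+\<omega>. ennreal (min (Z (enn2real (grid_hitting_time m E \<omega>)) \<omega>)
        (1 - Z (enn2real (grid_hitting_time m E \<omega>)) \<omega>)) + ennreal c * grid_hitting_time m E \<omega> \<partial>M)"
proof -
  let ?t = "\<lambda>k. real k / real m"
  let ?X = "\<lambda>\<omega> s. observation \<mu> Y W s \<omega>" and ?X' = "\<lambda>\<omega> s. observation \<mu> Y' W' s \<omega>"
  have "\<forall>k. \<exists>B. B \<in> sets (path_algebra (ennreal (?t k))) \<and> E k = {\<omega> \<in> space M. ?X \<omega> \<in> B}"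
    by (rule allI, rule natural_filtration_path_set[OF E]) blast
  from choice[OF this] obtain B where B: "\<And>k. B k \<in> sets (path_algebra (ennreal (?t k)))"
      "\<And>k. E k = {\<omega> \<in> space M. ?X \<omega> \<in> B k}" by blast
  \<comment> \<open>At 1/2 the costs \<open>Z\<close> and \<open>1 - Z\<close> of the two decisions
    cross, so announcing 1 exactly on this event attains their minimum.\<close>
  have half: "{\<omega> \<in> space M. 1 / 2 \<le> Z (?t k) \<omega>} \<in> sets (F (ennreal (?t k)))" for k
    using measurable_sets[OF Z_measurable[of "?t k"], of "{1 / 2..}"]
    by (simp add: vimage_def Int_def conj_commute)
  have "\<forall>k. \<exists>D. D \<in> sets (path_algebra (ennreal (?t k))) \<and>
      {\<omega> \<in> space M. 1 / 2 \<le> Z (?t k) \<omega>} = {\<omega> \<in> space M. ?X \<omega> \<in> D}"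
    by (rule allI, rule natural_filtration_path_set[OF half]) blast
  from choice[OF this] obtain D where D: "\<And>k. D k \<in> sets (path_algebra (ennreal (?t k)))"
      "\<And>k. {\<omega> \<in> space M. 1 / 2 \<le> Z (?t k) \<omega>} = {\<omega> \<in> space M. ?X \<omega> \<in> D k}" by blast
  have path_mono: "A \<in> sets (path_algebra (ennreal (?t k)))"
    if "A \<in> sets (path_algebra (ennreal (?t j)))" "j \<le> k" for A j k
  proof -
    have "ennreal (?t j) \<le> ennreal (?t k)"
      using \<open>j \<le> k\<close> by (intro ennreal_leI divide_right_mono) auto
    from natural_filtration_mono[OF this] that(1) show ?thesis by blast
  qed
  \<comment> \<open>The formula for the decision error asks for events known at time
    \<open>k / m\<close> itself; the earlier sets qualify because the path algebras
    increase.\<close>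
  have disj: "disjointed B k \<in> sets (path_algebra (ennreal (?t k)))" for k
    unfolding disjointed_def using path_mono[OF B(1)] B(1) by (intro sets.Diff sets.finite_UN) auto
  have path_inf: "A \<in> sets (path_algebra (ennreal (?t k))) \<Longrightarrow> A \<in> sets (path_algebra \<infinity>)" for A k
    using natural_filtration_mono[of "ennreal (?t k)" \<infinity>] by auto
  note [measurable] = path_inf[OF disj] path_inf[OF D(1)] path_inf[OF B(1)]
  define E' where "E' k = {\<omega> \<in> space N. ?X' \<omega> \<in> B k}" for k
  define D' where "D' k = {\<omega> \<in> space N. ?X' \<omega> \<in> D k}" for k
  have path': "?X' \<in> F' t \<rightarrow>\<^sub>M path_algebra t" for t
    by (intro measurable_path_algebraI adapted')
  have space': "space (F' t) = space N" for t
    using subalgebra' by (simp add: subalgebra_def)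
  have pull': "A \<in> sets (path_algebra t) \<Longrightarrow> {\<omega> \<in> space N. ?X' \<omega> \<in> A} \<in> sets (F' t)" for A t
    using measurable_sets[OF path'[of t], of A] by (simp add: vimage_def Int_def conj_commute space')
  have F'N: "A \<in> sets (F' t) \<Longrightarrow> A \<in> sets N" for A t
    using subalgebra' by (auto simp: subalgebra_def)
  have FM: "A \<in> sets (F t) \<Longrightarrow> A \<in> sets M" for A t
    using M.subalgebra_observation by (auto simp: subalgebra_def)
  have E': "E' k \<in> sets (F' (ennreal (?t k)))" and D': "D' k \<in> sets (F' (ennreal (?t k)))" for k
    unfolding E'_def D'_def by (rule pull'[OF B(1)], rule pull'[OF D(1)])
  have disjE: "disjointed E k = {\<omega> \<in> space M. ?X \<omega> \<in> disjointed B k}" for k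
    unfolding disjointed_def B(2) by auto
  have disjE': "disjointed E' k = {\<omega> \<in> space N. ?X' \<omega> \<in> disjointed B k}" for k
    unfolding disjointed_def E'_def by auto
  have disjE'_sets: "disjointed E' k \<in> sets (F' (ennreal (?t k)))" for k
    unfolding disjE' by (rule pull'[OF disj])
  have disjE_sets: "disjointed E k \<in> sets (F (ennreal (?t k)))" for k
    using measurable_sets[OF measurable_path_natural_filtration[of "observation \<mu> Y W" "space M"] disj[of k]]
    by (simp add: vimage_def Int_def conj_commute disjE)
  define T' where "T' = grid_hitting_time m E'"
  let ?T = "grid_hitting_time m E"

  \<comment> \<open>Almost sure stopping is a property of the path alone, so it transfers through
    the law of the observation.\<close>
  have fin': "AE \<omega> in N. \<exists>k. \<omega> \<in> E' k"
  proof -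
    have "UNIV \<times> (UNIV - (\<Union>k. B k)) \<in> sets (borel \<Otimes>\<^sub>M path_algebra \<infinity>)"
    proof (rule pair_measureI)
      have "(\<Union>k. B k) \<in> sets (path_algebra \<infinity>)"
        using path_inf[OF B(1)] by (intro sets.countable_UN) (auto simp del: infinity_ennreal_def)
      from sets.compl_sets[OF this] show "UNIV - (\<Union>k. B k) \<in> sets (path_algebra \<infinity>)" by simp
    qed simp
    from observation_law_eq[OF this]
    have "emeasure N {\<omega> \<in> space N. \<not> (\<exists>k. ?X' \<omega> \<in> B k)} = emeasure M {\<omega> \<in> space M. \<not> (\<exists>k. ?X \<omega> \<in> B k)}"
      by simp
    also have "\<dots> = 0"
    proof -
      have "{\<omega> \<in> space M. \<not> (\<exists>k. ?X \<omega> \<in> B k)} = space M - (\<Union>k. E k)"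
        by (auto simp: B(2))
      moreover have "space M - (\<Union>k. E k) \<in> sets M" using FM[OF E] by auto
      ultimately show ?thesis
        using fin by (subst (asm) AE_iff_measurable[where N="space M - (\<Union>k. E k)"]) auto
    qed
    finally have "emeasure N {\<omega> \<in> space N. \<not> (\<exists>k. ?X' \<omega> \<in> B k)} = 0" .
    moreover have "{\<omega> \<in> space N. \<not> (\<exists>k. ?X' \<omega> \<in> B k)} = space N - (\<Union>k. E' k)"
      by (auto simp: E'_def)
    moreover have "space N - (\<Union>k. E' k) \<in> sets N" using F'N[OF E'] by auto
    ultimately show ?thesis
      by (subst AE_iff_measurable[where N="space N - (\<Union>k. E' k)"]) auto
  qed
  have stop: "stopping_time F' T'"
    unfolding T'_def by (rule stopping_time_grid_hitting_time[where F=F', OF space' mono' E'])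
  have fin_T': "AE \<omega> in N. T' \<omega> < \<infinity>"
    using fin' by eventually_elim (auto simp: T'_def grid_hitting_time_def)
  \<comment> \<open>The only inequality in this chain is its first step: the imported decision
    \<open>D'\<close> need not be optimal for \<open>Z'\<close>, and the minimum lies below the cost
    of any decision. The remaining steps are equalities between error probabilities.\<close>
  have error: "(\<integral>\<^sup>+\<omega>. ennreal (min (Z' (?t k) \<omega>) (1 - Z' (?t k) \<omega>)) * indicator (disjointed E' k) \<omega> \<partial>N) \<le>
      (\<integral>\<^sup>+\<omega>. ennreal (min (Z (?t k) \<omega>) (1 - Z (?t k) \<omega>)) * indicator (disjointed E k) \<omega> \<partial>M)" for k
  proof -
    \<comment> \<open>Wrong decisions upon stopping at index \<open>k\<close>, as a set of pairs of
      hypothesis and path; in this form the joint law applies.\<close>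
    define S where "S = {z :: real \<times> (real \<Rightarrow> real). snd z \<in> disjointed B k \<and> (snd z \<in> D k) \<noteq> (fst z = 1)}"
    have "{z \<in> space (borel \<Otimes>\<^sub>M path_algebra \<infinity>). snd z \<in> disjointed B k \<and> (snd z \<in> D k) \<noteq> (fst z = (1::real))}
        \<in> sets (borel \<Otimes>\<^sub>M path_algebra \<infinity>)"
      by measurable
    then have S: "S \<in> sets (borel \<Otimes>\<^sub>M path_algebra \<infinity>)"
      by (simp add: S_def space_pair_measure)
    have "(\<integral>\<^sup>+\<omega>. ennreal (min (Z' (?t k) \<omega>) (1 - Z' (?t k) \<omega>)) * indicator (disjointed E' k) \<omega> \<partial>N) \<le>
        (\<integral>\<^sup>+\<omega>. ennreal (if \<omega> \<in> D' k then 1 - Z' (?t k) \<omega> else Z' (?t k) \<omega>) * indicator (disjointed E' k) \<omega> \<partial>N)"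
      by (intro nn_integral_mono mult_right_mono ennreal_leI) auto
    also have "\<dots> = emeasure N {\<omega> \<in> disjointed E' k. (\<omega> \<in> D' k) \<noteq> (Y' \<omega> = 1)}"
      by (rule N.posterior_decision_error[OF subalgebra' posterior' N.Y_measurable N.Y_cases _ disjE'_sets D']) auto
    also have "{\<omega> \<in> disjointed E' k. (\<omega> \<in> D' k) \<noteq> (Y' \<omega> = 1)} = {\<omega> \<in> space N. (Y' \<omega>, ?X' \<omega>) \<in> S}"
      by (auto simp: disjE' D'_def S_def)
    also have "emeasure N {\<omega> \<in> space N. (Y' \<omega>, ?X' \<omega>) \<in> S} = emeasure M {\<omega> \<in> space M. (Y \<omega>, ?X \<omega>) \<in> S}"
      by (rule observation_law_eq[OF S])
    also have "{\<omega> \<in> space M. (Y \<omega>, ?X \<omega>) \<in> S} =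
        {\<omega> \<in> disjointed E k. (\<omega> \<in> {\<omega> \<in> space M. 1 / 2 \<le> Z (?t k) \<omega>}) \<noteq> (Y \<omega> = 1)}"
      unfolding D(2) by (auto simp: disjE S_def)
    also have "emeasure M \<dots> = (\<integral>\<^sup>+\<omega>. ennreal (if \<omega> \<in> {\<omega> \<in> space M. 1 / 2 \<le> Z (?t k) \<omega>} then 1 - Z (?t k) \<omega> else Z (?t k) \<omega>) *
        indicator (disjointed E k) \<omega> \<partial>M)"
      by (rule M.posterior_decision_error[OF M.subalgebra_observation posterior M.Y_measurable M.Y_cases _ disjE_sets half, symmetric]) auto
    also have "\<dots> = (\<integral>\<^sup>+\<omega>. ennreal (min (Z (?t k) \<omega>) (1 - Z (?t k) \<omega>)) * indicator (disjointed E k) \<omega> \<partial>M)"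
      by (intro nn_integral_cong arg_cong2[where f="(*)"] arg_cong[where f=ennreal]) auto
    finally show ?thesis .
  qed
  have time: "emeasure N (disjointed E' k) = emeasure M (disjointed E k)" for k
  proof -
    have "UNIV \<times> disjointed B k \<in> sets (borel \<Otimes>\<^sub>M path_algebra \<infinity>)"
      by (intro pair_measureI path_inf[OF disj]) auto
    from observation_law_eq[OF this] show ?thesis by (simp add: disjE disjE')
  qed
  have "optimal_stopping_value N F' V G c \<le>
      (\<integral>\<^sup>+\<omega>. ennreal (G (V (enn2real (T' \<omega>)) \<omega>)) + ennreal c * T' \<omega> \<partial>N)"
    unfolding optimal_stopping_value_def using stop fin_T' by (intro INF_lower) simp
  also have "\<dots> \<le> (\<integral>\<^sup>+\<omega>. ennreal (min (Z' (enn2real (T' \<omega>)) \<omega>) (1 - Z' (enn2real (T' \<omega>)) \<omega>)) + ennreal c * T' \<omega> \<partial>N)"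
    by (intro nn_integral_mono add_right_mono ennreal_leI G)
  also have "\<dots> = (\<Sum>k. (\<integral>\<^sup>+\<omega>. ennreal (min (Z' (?t k) \<omega>) (1 - Z' (?t k) \<omega>)) * indicator (disjointed E' k) \<omega> \<partial>N) +
      ennreal c * ennreal (?t k) * emeasure N (disjointed E' k))"
    unfolding T'_def using F'N[OF E'] fin' Z'_measurable_N
    by (intro nn_integral_grid_hitting_time[where f="\<lambda>t \<omega>. ennreal (min (Z' t \<omega>) (1 - Z' t \<omega>))"]) auto
  also have "\<dots> \<le> (\<Sum>k. (\<integral>\<^sup>+\<omega>. ennreal (min (Z (?t k) \<omega>) (1 - Z (?t k) \<omega>)) * indicator (disjointed E k) \<omega> \<partial>M) +
      ennreal c * ennreal (?t k) * emeasure M (disjointed E k))"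
    unfolding time by (intro suminf_le add_right_mono error) auto
  also have "\<dots> = (\<integral>\<^sup>+\<omega>. ennreal (min (Z (enn2real (?T \<omega>)) \<omega>) (1 - Z (enn2real (?T \<omega>)) \<omega>)) + ennreal c * ?T \<omega> \<partial>M)"
    using FM[OF E] fin Z_measurable_M
    by (intro nn_integral_grid_hitting_time[where f="\<lambda>t \<omega>. ennreal (min (Z t \<omega>) (1 - Z t \<omega>))", symmetric]) auto
  finally show ?thesis .
qed

end

section \<open>Removing the grid\<close>

lemma grid_hitting_time_sublevel_bounds:
  fixes \<tau> :: "'a \<Rightarrow> ennreal"
  assumes m: "0 < m" and \<tau>: "\<tau> \<omega> = ennreal r" "0 \<le> r" and \<omega>: "\<omega> \<in> \<Omega>"
  defines "E \<equiv> \<lambda>k. {\<omega> \<in> \<Omega>. \<tau> \<omega> \<le> ennreal (real k / real m)}"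
  obtains s where "grid_hitting_time m E \<omega> = ennreal s" "r \<le> s" "s \<le> r + 1 / real m"
proof -
  let ?k = "LEAST k. \<omega> \<in> E k"
  \<comment> \<open>An explicit index at which the sublevel event has occurred. The least such index
    is no larger, and the ceiling adds at most 1, that is, one mesh width in time.\<close>
  define k where "k = nat \<lceil>r * real m\<rceil>"
  have iff: "\<omega> \<in> E j \<longleftrightarrow> r \<le> real j / real m" for j
    using \<tau> \<omega> by (simp add: E_def)
  have rm: "0 \<le> r * real m" using \<tau>(2) by simp
  have k: "r * real m \<le> real k" "real k \<le> r * real m + 1"
    unfolding k_def using rm by linarith+
  have in_E: "\<omega> \<in> E k" unfolding iff using k(1) m by (simp add: field_simps)
  have "r \<le> real ?k / real m"
    using LeastI[of "\<lambda>k. \<omega> \<in> E k", OF in_E] unfolding iff .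
  moreover have "real ?k \<le> r * real m + 1"
    using Least_le[of "\<lambda>k. \<omega> \<in> E k", OF in_E] k(2) by linarith
  then have "real ?k / real m \<le> r + 1 / real m"
    using m by (simp add: field_simps)
  moreover have "grid_hitting_time m E \<omega> = ennreal (real ?k / real m)"
    using in_E by (auto simp: grid_hitting_time_def)
  ultimately show ?thesis using that by metis
qed

context test_embedding
begin

lemma optimal_stopping_value_le:
  assumes G: "\<And>t \<omega>. G (V t \<omega>) \<le> min (Z' t \<omega>) (1 - Z' t \<omega>)"
  shows "optimal_stopping_value N F' V G c \<le> optimal_stopping_value M F Z (\<lambda>x. min x (1 - x)) c"
  unfolding optimal_stopping_value_def[of M]
proof (rule INF_greatest)
  fix \<tau> assume "\<tau> \<in> {\<tau>. stopping_time F \<tau> \<and> (AE \<omega> in M. \<tau> \<omega> < \<infinity>)}"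
  then have \<tau>: "stopping_time F \<tau>" and \<tau>_fin: "AE \<omega> in M. \<tau> \<omega> < \<infinity>" by auto
  let ?g = "\<lambda>t \<omega>. ennreal (min (Z t \<omega>) (1 - Z t \<omega>))"
  let ?v = "\<integral>\<^sup>+\<omega>. ?g (enn2real (\<tau> \<omega>)) \<omega> + ennreal c * \<tau> \<omega> \<partial>M"
  have FM: "A \<in> sets (F t) \<Longrightarrow> A \<in> sets M" for A t
    using M.subalgebra_observation by (auto simp: subalgebra_def)
  have \<tau>_meas [measurable]: "\<tau> \<in> borel_measurable M"
    using FM by (intro measurable_stopping_time[OF \<tau>]) auto
  \<comment> \<open>Meshes \<open>1 / Suc n\<close> avoid division by 0 and never exceed 1, which
    the dominating function below relies on.\<close>
  define E where "E n k = {\<omega> \<in> space M. \<tau> \<omega> \<le> ennreal (real k / real (Suc n))}" for n k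
  define T where "T n = grid_hitting_time (Suc n) (E n)" for n
  let ?u = "\<lambda>n \<omega>. ?g (enn2real (T n \<omega>)) \<omega> + ennreal c * T n \<omega>"
  have E: "E n k \<in> sets (F (ennreal (real k / real (Suc n))))" for n k
    using stopping_timeD[OF \<tau>, of "ennreal (real k / real (Suc n))"]
    by (simp add: E_def Measurable.pred_def)
  have bounds: "\<exists>r s. \<tau> \<omega> = ennreal r \<and> 0 \<le> r \<and> (\<forall>n. T n \<omega> = ennreal (s n) \<and> r \<le> s n \<and> s n \<le> r + 1 / real (Suc n))"
    if "\<omega> \<in> space M" "\<tau> \<omega> < \<infinity>" for \<omega>
  proof -
    obtain r where r: "\<tau> \<omega> = ennreal r" "0 \<le> r"
      using \<open>\<tau> \<omega> < \<infinity>\<close> by (cases "\<tau> \<omega>") auto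
    have "\<exists>s. T n \<omega> = ennreal s \<and> r \<le> s \<and> s \<le> r + 1 / real (Suc n)" for n
      unfolding T_def E_def[abs_def]
      by (rule grid_hitting_time_sublevel_bounds[of "Suc n" \<tau> \<omega> r "space M", OF _ r \<open>\<omega> \<in> space M\<close>]) auto
    then show ?thesis using r by metis
  qed
  have fin: "AE \<omega> in M. \<exists>k. \<omega> \<in> E n k" for n
    using \<tau>_fin AE_space
  proof eventually_elim
    fix \<omega> assume "\<tau> \<omega> < \<infinity>" "\<omega> \<in> space M"
    from bounds[OF this(2,1)] have "T n \<omega> < \<infinity>" by auto
    then show "\<exists>k. \<omega> \<in> E n k" by (auto simp: T_def grid_hitting_time_def split: if_splits)
  qed
  have le: "optimal_stopping_value N F' V G c \<le> (\<integral>\<^sup>+\<omega>. ?u n \<omega> \<partial>M)" for n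
    unfolding T_def by (rule optimal_stopping_value_le_grid[where E="E n" and m="Suc n" and G=G and V=V, OF G E fin])
  show "optimal_stopping_value N F' V G c \<le> ?v"
  \<comment> \<open>An infinite cost makes the bound trivial. A finite one bounds the expected
    observation cost and thereby yields an integrable majorant.\<close>
  proof (cases "?v = \<infinity>")
    case False
    have u_meas [measurable]: "?u n \<in> borel_measurable M" for n
      unfolding T_def using FM[OF E] Z_measurable_M
      by (intro borel_measurable_grid_hitting_time[where f="?g"]) auto
    have "AE \<omega> in M. continuous_on {0..} (\<lambda>t. Z t \<omega>)"
      using posterior by (simp add: posterior_process_def)
    with \<tau>_fin AE_space
    have conv: "AE \<omega> in M. (\<lambda>n. ?u n \<omega>) \<longlonglongrightarrow> ?g (enn2real (\<tau> \<omega>)) \<omega> + ennreal c * \<tau> \<omega>"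
    proof eventually_elim
      fix \<omega> assume \<omega>: "\<tau> \<omega> < \<infinity>" "\<omega> \<in> space M" "continuous_on {0..} (\<lambda>t. Z t \<omega>)"
      obtain r s where r: "\<tau> \<omega> = ennreal r" "0 \<le> r"
        and s: "\<And>n. T n \<omega> = ennreal (s n)" "\<And>n. r \<le> s n" "\<And>n. s n \<le> r + 1 / real (Suc n)"
        using bounds[OF \<omega>(2,1)] by metis
      have "(\<lambda>n. r + 1 / real (Suc n)) \<longlonglongrightarrow> r + 0"
        by (intro tendsto_intros LIMSEQ_Suc[OF lim_1_over_n])
      then have lim: "s \<longlonglongrightarrow> r"
        by (intro tendsto_sandwich[of "\<lambda>_. r" s sequentially]) (use s in auto)
      have s0: "0 \<le> s n" for n using s(2)[of n] r(2) by simp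
      have "(\<lambda>n. Z (s n) \<omega>) \<longlonglongrightarrow> Z r \<omega>"
        by (rule continuous_on_tendsto_compose[OF \<omega>(3) lim]) (use r s0 in auto)
      then have "(\<lambda>n. ?g (s n) \<omega> + ennreal c * ennreal (s n)) \<longlonglongrightarrow> ?g r \<omega> + ennreal c * ennreal r"
        by (intro tendsto_add tendsto_ennrealI tendsto_min tendsto_diff tendsto_const
            ennreal_tendsto_cmult lim) auto
      then show "(\<lambda>n. ?u n \<omega>) \<longlonglongrightarrow> ?g (enn2real (\<tau> \<omega>)) \<omega> + ennreal c * \<tau> \<omega>"
        by (simp add: r s(1) s0)
    qed
    \<comment> \<open>Paths of \<open>Z\<close> are continuous only almost surely, so measurability
      of \<open>Z\<close> at the random time \<open>\<tau>\<close> is not at hand. The liminf of the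
      grid costs is measurable and agrees with the limit cost almost everywhere.\<close>
    define u where "u \<omega> = liminf (\<lambda>n. ?u n \<omega>)" for \<omega>
    have [measurable]: "u \<in> borel_measurable M"
      unfolding u_def by measurable
    have u_eq: "AE \<omega> in M. ?g (enn2real (\<tau> \<omega>)) \<omega> + ennreal c * \<tau> \<omega> = u \<omega>"
      using conv by eventually_elim (simp add: u_def lim_imp_Liminf)
    have "(\<lambda>n. \<integral>\<^sup>+\<omega>. ?u n \<omega> \<partial>M) \<longlonglongrightarrow> (\<integral>\<^sup>+\<omega>. u \<omega> \<partial>M)"
    \<comment> \<open>The 1 dominates \<open>min z (1 - z)\<close>, which holds for every real z,
      and \<open>\<tau> + 1\<close> dominates the rounded time because the mesh is at most
      1.\<close>
    proof (rule nn_integral_dominated_convergence[where w="\<lambda>\<omega>. 1 + ennreal c * (\<tau> \<omega> + 1)"])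
      have "(\<integral>\<^sup>+\<omega>. ennreal c * \<tau> \<omega> \<partial>M) \<le> ?v"
        by (intro nn_integral_mono) simp
      also have "\<dots> < \<infinity>" using False by (simp add: less_top)
      finally show "(\<integral>\<^sup>+\<omega>. 1 + ennreal c * (\<tau> \<omega> + 1) \<partial>M) < \<infinity>"
        by (simp add: distrib_left nn_integral_add M.emeasure_space_1 ennreal_mult_less_top)
      show "AE \<omega> in M. ?u n \<omega> \<le> 1 + ennreal c * (\<tau> \<omega> + 1)" for n
        using \<tau>_fin AE_space
      proof eventually_elim
        fix \<omega> assume \<omega>: "\<tau> \<omega> < \<infinity>" "\<omega> \<in> space M"
        obtain r s where r: "\<tau> \<omega> = ennreal r" "0 \<le> r"
          and s: "T n \<omega> = ennreal s" "s \<le> r + 1 / real (Suc n)"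
          using bounds[OF \<omega>(2,1)] by metis
        have "1 / real (Suc n) \<le> 1" by simp
        with s(2) have "s \<le> r + 1" by linarith
        then have "T n \<omega> \<le> \<tau> \<omega> + 1"
          using r s(1) by (metis ennreal_1 ennreal_leI ennreal_plus zero_le_one)
        moreover have "?g t \<omega> \<le> 1" for t
          by (simp add: ennreal_le_1)
        ultimately show "?u n \<omega> \<le> 1 + ennreal c * (\<tau> \<omega> + 1)"
          by (intro add_mono mult_left_mono) auto
      qed
      show "AE \<omega> in M. (\<lambda>n. ?u n \<omega>) \<longlonglongrightarrow> u \<omega>"
        using conv u_eq by eventually_elim simp
    qed measurable
    also have "(\<integral>\<^sup>+\<omega>. u \<omega> \<partial>M) = ?v"
      by (rule nn_integral_cong_AE[symmetric]) (rule u_eq)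
    finally show ?thesis
      by (rule LIMSEQ_le_const) (use le in auto)
  qed simp
qed

end

section \<open>From the two models to the comparison of values\<close>

lemma (in prob_space) indep_sets_pairD:
  assumes "indep_sets A I" "i \<in> I" "j \<in> I" "i \<noteq> j" "a \<in> A i" "b \<in> A j"
  shows "prob (a \<inter> b) = prob a * prob b"
  using indep_setsD[OF assms(1), of "{i, j}" "\<lambda>k. if k = i then a else b"] assms
  by (auto simp: Int_commute)

lemma testing_model1_single_test:
  assumes "testing_model1 \<mu> P Y W Z" "p \<in> {0..1}"
  shows "single_test (P p) p Y W"
proof -
  have P: "prob_space (P p)" and rv: "bernoulli_rv (P p) p Y" "standard_brownian_motion (P p) W"
    and indep: "prob_space.indep_set (P p) (sets (vimage_algebra (space (P p)) Y borel))
      (sets (natural_filtration (space (P p)) W \<infinity>))"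
    using assms unfolding testing_model1_def by blast+
  show ?thesis
    by (intro single_test.intro single_test_axioms.intro P rv prob_space.indep_setD[OF P indep])
qed

lemma testing_model2_single_test:
  assumes "testing_model2 \<mu>1 \<mu>2 P Y1 Y2 W1 W2 Z" "p \<in> {0..1} \<times> {0..1}"
  shows testing_model2_single_test1: "single_test (P p) (fst p) Y1 W1"
    and testing_model2_single_test2: "single_test (P p) (snd p) Y2 W2"
proof -
  have P: "prob_space (P p)" and
    rv: "bernoulli_rv (P p) (fst p) Y1" "bernoulli_rv (P p) (snd p) Y2"
      "standard_brownian_motion (P p) W1" "standard_brownian_motion (P p) W2" and
    indep: "prob_space.indep_sets (P p)
          (\<lambda>k. [sets (vimage_algebra (space (P p)) Y1 borel),
                sets (vimage_algebra (space (P p)) Y2 borel),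
                sets (natural_filtration (space (P p)) W1 \<infinity>),
                sets (natural_filtration (space (P p)) W2 \<infinity>)] ! k) {..<4}"
    using assms unfolding testing_model2_def by blast+
  interpret prob_space "P p" by (rule P)
  \<comment> \<open>In the independent family the indices 0, 1, 2, 3 belong to \<open>Y1\<close>,
    \<open>Y2\<close>, \<open>W1\<close>, \<open>W2\<close>; each coordinate uses its matching pair,
    here 0 and 2.\<close>
  have "prob (a \<inter> b) = prob a * prob b"
    if "a \<in> sets (vimage_algebra (space (P p)) Y1 borel)"
      "b \<in> sets (natural_filtration (space (P p)) W1 \<infinity>)" for a b
    by (rule indep_sets_pairD[OF indep, of 0 2]) (use that in simp_all)
  then show "single_test (P p) (fst p) Y1 W1"
    by (intro single_test.intro single_test_axioms.intro P rv)
  have "prob (a \<inter> b) = prob a * prob b"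
    if "a \<in> sets (vimage_algebra (space (P p)) Y2 borel)"
      "b \<in> sets (natural_filtration (space (P p)) W2 \<infinity>)" for a b
    by (rule indep_sets_pairD[OF indep, of 1 3]) (use that in simp_all)
  then show "single_test (P p) (snd p) Y2 W2"
    by (intro single_test.intro single_test_axioms.intro P rv)
qed

lemma filtration2_properties:
  assumes "testing_model2 \<mu>1 \<mu>2 P Y1 Y2 W1 W2 Z" "p \<in> {0..1} \<times> {0..1}"
  defines "F \<equiv> filtration2 \<mu>1 \<mu>2 P Y1 Y2 W1 W2 p"
  shows subalgebra_filtration2: "subalgebra (P p) (F t)"
    and filtration2_mono: "s \<le> t \<Longrightarrow> sets (F s) \<subseteq> sets (F t)"
    and filtration2_adapted1: "0 \<le> r \<Longrightarrow> ennreal r \<le> t \<Longrightarrow> observation \<mu>1 Y1 W1 r \<in> borel_measurable (F t)"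
    and filtration2_adapted2: "0 \<le> r \<Longrightarrow> ennreal r \<le> t \<Longrightarrow> observation \<mu>2 Y2 W2 r \<in> borel_measurable (F t)"
proof -
  interpret T1: single_test "P p" "fst p" Y1 W1
    using assms(1,2) by (rule testing_model2_single_test1)
  interpret T2: single_test "P p" "snd p" Y2 W2
    using assms(1,2) by (rule testing_model2_single_test2)
  show "subalgebra (P p) (F t)"
    unfolding F_def filtration2_def
    by (intro subalgebra_natural_filtration borel_measurable_Pair
        T1.observation_measurable T2.observation_measurable)
  show "sets (F s) \<subseteq> sets (F t)" if "s \<le> t"
    unfolding F_def filtration2_def using that by (rule natural_filtration_mono)
  assume r: "0 \<le> r" "ennreal r \<le> t"
  have "(\<lambda>\<omega>. (observation \<mu>1 Y1 W1 r \<omega>, observation \<mu>2 Y2 W2 r \<omega>)) \<in> borel_measurable (F t)"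
    unfolding F_def filtration2_def
    by (rule measurable_natural_filtration_component[OF r,
        where X="\<lambda>t \<omega>. (observation \<mu>1 Y1 W1 t \<omega>, observation \<mu>2 Y2 W2 t \<omega>)"])
  from measurable_compose[OF this borel_measurable_continuous_onI[OF continuous_on_fst[OF continuous_on_id]]]
    measurable_compose[OF this borel_measurable_continuous_onI[OF continuous_on_snd[OF continuous_on_id]]]
  show "observation \<mu>1 Y1 W1 r \<in> borel_measurable (F t)"
    "observation \<mu>2 Y2 W2 r \<in> borel_measurable (F t)" by simp_all
qed

text \<open>Both differences between the problems act in the same direction: \<open>g\<close> is at
  most the terminal cost of the first coordinate, and the larger filtration admits every rule based
  on that coordinate. The prior \<open>y\<close> is free because the joint law of the first
  hypothesis and its observation depends on \<open>x\<close> only.\<close>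

lemma value2_le_value1_fst:
  assumes model2: "testing_model2 \<mu>1 \<mu>2 P Y1 Y2 W1 W2 Z"
    and model1: "testing_model1 \<mu>1 Q U B Z1" and xy: "x \<in> {0..1}" "y \<in> {0..1}"
  shows "value2 \<mu>1 \<mu>2 c P Y1 Y2 W1 W2 Z (x, y) \<le> value1 \<mu>1 c Q U B Z1 x"
proof -
  have p: "(x, y) \<in> {0..1} \<times> {0..1}" using xy by simp
  interpret test_embedding "Q x" x U B "P (x, y)" Y1 W1 \<mu>1 "Z1 x" "\<lambda>t \<omega>. fst (Z (x, y) t \<omega>)"
    "filtration2 \<mu>1 \<mu>2 P Y1 Y2 W1 W2 (x, y)"
  proof (intro test_embedding.intro test_embedding_axioms.intro)
    show "single_test (Q x) x U B" by (rule testing_model1_single_test[OF model1 xy(1)])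
    show "single_test (P (x, y)) x Y1 W1" using testing_model2_single_test1[OF model2 p] by simp
    show "posterior_process (Q x) (natural_filtration (space (Q x)) (observation \<mu>1 U B)) U (Z1 x)"
      using model1 xy(1) by (auto simp: testing_model1_def filtration1_def)
    show "posterior_process (P (x, y)) (filtration2 \<mu>1 \<mu>2 P Y1 Y2 W1 W2 (x, y)) Y1 (\<lambda>t \<omega>. fst (Z (x, y) t \<omega>))"
      using model2 p unfolding testing_model2_def by blast
  qed (use subalgebra_filtration2[OF model2 p] filtration2_mono[OF model2 p] filtration2_adapted1[OF model2 p] in auto)
  show ?thesis
    unfolding value2_def value1_def filtration1_def
    by (rule optimal_stopping_value_le) (auto simp: g_def case_prod_beta min_le_iff_disj)
qed

lemma value2_le_value1_snd:
  assumes model2: "testing_model2 \<mu>1 \<mu>2 P Y1 Y2 W1 W2 Z"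
    and model1: "testing_model1 \<mu>2 Q U B Z2" and xy: "x \<in> {0..1}" "y \<in> {0..1}"
  shows "value2 \<mu>1 \<mu>2 c P Y1 Y2 W1 W2 Z (x, y) \<le> value1 \<mu>2 c Q U B Z2 y"
proof -
  have p: "(x, y) \<in> {0..1} \<times> {0..1}" using xy by simp
  interpret test_embedding "Q y" y U B "P (x, y)" Y2 W2 \<mu>2 "Z2 y" "\<lambda>t \<omega>. snd (Z (x, y) t \<omega>)"
    "filtration2 \<mu>1 \<mu>2 P Y1 Y2 W1 W2 (x, y)"
  proof (intro test_embedding.intro test_embedding_axioms.intro)
    show "single_test (Q y) y U B" by (rule testing_model1_single_test[OF model1 xy(2)])
    show "single_test (P (x, y)) y Y2 W2" using testing_model2_single_test2[OF model2 p] by simp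
    show "posterior_process (Q y) (natural_filtration (space (Q y)) (observation \<mu>2 U B)) U (Z2 y)"
      using model1 xy(2) by (auto simp: testing_model1_def filtration1_def)
    show "posterior_process (P (x, y)) (filtration2 \<mu>1 \<mu>2 P Y1 Y2 W1 W2 (x, y)) Y2 (\<lambda>t \<omega>. snd (Z (x, y) t \<omega>))"
      using model2 p unfolding testing_model2_def by blast
  qed (use subalgebra_filtration2[OF model2 p] filtration2_mono[OF model2 p] filtration2_adapted2[OF model2 p] in auto)
  show ?thesis
    unfolding value2_def value1_def filtration1_def
    by (rule optimal_stopping_value_le) (auto simp: g_def case_prod_beta min_le_iff_disj)
qed

theorem proposition4p4:
  fixes \<mu>1 \<mu>2 c A1 A2 :: real
    and P :: "real \<times> real \<Rightarrow> 'a measure"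
    and Y1 Y2 :: "'a \<Rightarrow> real"
    and W1 W2 :: "real \<Rightarrow> 'a \<Rightarrow> real"
    and Z :: "real \<times> real \<Rightarrow> real \<Rightarrow> 'a \<Rightarrow> real \<times> real"
    and Q1 :: "real \<Rightarrow> 'b measure"
    and U1 :: "'b \<Rightarrow> real" and B1 :: "real \<Rightarrow> 'b \<Rightarrow> real" and Z1 :: "real \<Rightarrow> real \<Rightarrow> 'b \<Rightarrow> real"
    and Q2 :: "real \<Rightarrow> 'd measure"
    and U2 :: "'d \<Rightarrow> real" and B2 :: "real \<Rightarrow> 'd \<Rightarrow> real" and Z2 :: "real \<Rightarrow> real \<Rightarrow> 'd \<Rightarrow> real"
  assumes "\<mu>1 > 0" and "\<mu>2 > 0" and "c > 0"
    and "testing_model2 \<mu>1 \<mu>2 P Y1 Y2 W1 W2 Z"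
    and "testing_model1 \<mu>1 Q1 U1 B1 Z1"
    and "testing_model1 \<mu>2 Q2 U2 B2 Z2"
    and "0 < A1" and "A1 < 1 / 2"
    and "continuation_region1 \<mu>1 c Q1 U1 B1 Z1 = {A1<..<1 - A1}"
    and "0 < A2" and "A2 < 1 / 2"
    and "continuation_region1 \<mu>2 c Q2 U2 B2 Z2 = {A2<..<1 - A2}"
  shows "{A1<..<1 - A1} \<times> {A2<..<1 - A2} \<subseteq> continuation_region2 \<mu>1 \<mu>2 c P Y1 Y2 W1 W2 Z"
proof clarify
  fix x y assume "x \<in> {A1<..<1 - A1}" "y \<in> {A2<..<1 - A2}"
  then have "x \<in> continuation_region1 \<mu>1 c Q1 U1 B1 Z1" "y \<in> continuation_region1 \<mu>2 c Q2 U2 B2 Z2"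
    using assms by simp_all
  then have xy: "x \<in> {0..1}" "y \<in> {0..1}"
    and "value1 \<mu>1 c Q1 U1 B1 Z1 x < ennreal (min x (1 - x))"
    and "value1 \<mu>2 c Q2 U2 B2 Z2 y < ennreal (min y (1 - y))"
    by (auto simp: continuation_region1_def)
  then have "value2 \<mu>1 \<mu>2 c P Y1 Y2 W1 W2 Z (x, y) < ennreal (g (x, y))"
    using value2_le_value1_fst[OF assms(4,5) xy, of c] value2_le_value1_snd[OF assms(4,6) xy, of c]
    by (cases "min x (1 - x) \<le> min y (1 - y)") (auto simp: g_def min_def intro: le_less_trans)
  then show "(x, y) \<in> continuation_region2 \<mu>1 \<mu>2 c P Y1 Y2 W1 W2 Z"
    using xy by (simp add: continuation_region2_def)
qed

end
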